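(* Let $n\ge 1$ be an integer, $\kappa>0$, let $C\subseteq\mathbb{H}^n_\kappa$ be a nonempty closed $\kappa$-hyperbolically convex set, let $q_1,\dots,q_m\in\mathbb{H}^n_\kappa$ be distinct points ($m\ge1$), let $\mu_1,\dots,\mu_m>0$ with $\sum_{j=1}^m\mu_j=1$, and let $\sigma\ge 2$. Consider the constrained center of mass problem $$\min_{p\in C}\ \zeta(p),\qquad \zeta(p):=\sum_{i=1}^m\mu_i\,d_\kappa^\sigma(p,q_i).$$ Let $(p_k)_{k\in\mathbb{N}}$ be an infinite sequence generated by the gradient projection method with backtracking step size (described in the context) applied to $f=\zeta$ and $C$, with $\operatorname{grad}\zeta(p_k)\ne 0$ for all $k$. Then $(p_k)_{k\in\mathbb{N}}$ converges to the (unique) solution of this problem.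
   Context: For $x,y\in\mathbb{R}^{n+1}$ the Lorentzian inner product is $\langle x,y\rangle:=x_1y_1+\dots+x_ny_n-x_{n+1}y_{n+1}$. The $\kappa$-hyperbolic space form is $\mathbb{H}^n_\kappa:=\{p\in\mathbb{R}^{n+1}:\langle p,p\rangle=-1/\kappa,\ p_{n+1}>0\}$, with tangent space $T_p\mathbb{H}^n_\kappa:=\{v\in\mathbb{R}^{n+1}:\langle p,v\rangle=0\}$, on which $\langle\cdot,\cdot\rangle$ is positive definite (a Riemannian metric), with norm $\|v\|=\sqrt{\langle v,v\rangle}$. The intrinsic distance is $d_\kappa(p,q):=\frac{1}{\sqrt\kappa}\operatorname{arcosh}(-\kappa\langle p,q\rangle)$, and $d_\kappa^\sigma$ denotes its $\sigma$-th power. Exponential map: $\exp^\kappa_p(0)=p$ and $\exp^\kappa_p(v)=\cosh(\sqrt\kappa\|v\|)\,p+\sinh(\sqrt\kappa\|v\|)\frac{v}{\sqrt\kappa\|v\|}$ for $0\ne v\in T_p\mathbb{H}^n_\kappa$. Its inverse is $\log^\kappa_p p=0$ and $\log^\kappa_p q=d_\kappa(p,q)\frac{q+\kappa\langle p,q\rangle p}{\|q+\kappa\langle p,q\rangle p\|}$ for $q\ne p$. The geodesic segment joining $p$ to $q$ is $\{\exp^\kappa_p(t\log^\kappa_p q):t\in[0,1]\}$. A set $C\subseteq\mathbb{H}^n_\kappa$ is $\kappa$-hyperbolically convex if for all $p,q\in C$ the geodesic segment joining $p$ to $q$ is contained in $C$. For a nonempty closed $\kappa$-hyperbolically convex set $C$,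 the intrinsic $\kappa$-projection $P^\kappa_C(p)$ of $p\in\mathbb{H}^n_\kappa$ is the unique minimizer of $q\mapsto d_\kappa(p,q)$ over $q\in C$. $\operatorname{grad} f(p)\in T_p\mathbb{H}^n_\kappa$ is the Riemannian gradient: $df(p)v=\langle\operatorname{grad} f(p),v\rangle$ for all $v\in T_p\mathbb{H}^n_\kappa$. Gradient projection method with backtracking step size: fix constants $\rho,\beta,\theta_0\in(0,1)$ and $\hat\alpha,\bar\alpha>0$, and an initial point $p_0\in C$. For $k=0,1,2,\dots$: choose any $\alpha_k$ with $0<\hat\alpha\le\alpha_k\le\bar\alpha$; set $y_k:=\exp^\kappa_{p_k}(-\alpha_k\operatorname{grad} f(p_k))$ and $z_k:=P^\kappa_C(y_k)$; let $q_k(\tau):=\exp^\kappa_{p_k}(\tau\log^\kappa_{p_k}z_k)$ and $$\ell_k:=\min\big\{\ell\in\{1,2,\dots\}: f(q_k(\beta^\ell\theta_k))\le f(p_k)+\rho\,\beta^\ell\theta_k\langle\operatorname{grad} f(p_k),\log^\kappa_{p_k}z_k\rangle\big\};$$ set $p_{k+1}:=q_k(\beta^{\ell_k}\theta_k)$ and $\theta_{k+1}:=\beta^{\ell_k-1}\theta_k$. (The method stops if $\operatorname{grad} f(p_k)=0$.) *)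

theory Defs
  imports "HOL-Analysis.Analysis"
begin

text \<open>
  The ambient space of dimension \<open>n + 1\<close> is \<open>(real ^ 'n) \<times> real\<close> with \<open>n = CARD('n)\<close>; the second
  component is the last (timelike) coordinate.
\<close>

definition lorentz :: "(real ^ 'n) \<times> real \<Rightarrow> (real ^ 'n) \<times> real \<Rightarrow> real" where
  "lorentz x y = (\<Sum>i\<in>UNIV. fst x $ i * fst y $ i) - snd x * snd y"

definition hyp_space :: "real \<Rightarrow> ((real ^ 'n) \<times> real) set" where
  "hyp_space \<kappa> = {p. lorentz p p = - 1 / \<kappa> \<and> snd p > 0}"

definition tangent_space :: "(real ^ 'n) \<times> real \<Rightarrow> ((real ^ 'n) \<times> real) set" where
  "tangent_space p = {v. lorentz p v = 0}"

definition lorentz_norm :: "(real ^ 'n) \<times> real \<Rightarrow> real" where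
  "lorentz_norm v = sqrt (lorentz v v)"

definition hyp_dist :: "real \<Rightarrow> (real ^ 'n) \<times> real \<Rightarrow> (real ^ 'n) \<times> real \<Rightarrow> real" where
  "hyp_dist \<kappa> p q = 1 / sqrt \<kappa> * arcosh (- \<kappa> * lorentz p q)"

definition hyp_exp ::
    "real \<Rightarrow> (real ^ 'n) \<times> real \<Rightarrow> (real ^ 'n) \<times> real \<Rightarrow> (real ^ 'n) \<times> real" where
  "hyp_exp \<kappa> p v =
    (if v = 0 then p
     else cosh (sqrt \<kappa> * lorentz_norm v) *\<^sub>R p
          + (sinh (sqrt \<kappa> * lorentz_norm v) / (sqrt \<kappa> * lorentz_norm v)) *\<^sub>R v)"

definition hyp_log ::
    "real \<Rightarrow> (real ^ 'n) \<times> real \<Rightarrow> (real ^ 'n) \<times> real \<Rightarrow> (real ^ 'n) \<times> real" where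
  "hyp_log \<kappa> p q =
    (if q = p then 0
     else (hyp_dist \<kappa> p q / lorentz_norm (q + (\<kappa> * lorentz p q) *\<^sub>R p))
          *\<^sub>R (q + (\<kappa> * lorentz p q) *\<^sub>R p))"

definition geodesic_segment ::
    "real \<Rightarrow> (real ^ 'n) \<times> real \<Rightarrow> (real ^ 'n) \<times> real \<Rightarrow> ((real ^ 'n) \<times> real) set" where
  "geodesic_segment \<kappa> p q = (\<lambda>t. hyp_exp \<kappa> p (t *\<^sub>R hyp_log \<kappa> p q)) ` {0..1}"

definition hyp_convex :: "real \<Rightarrow> ((real ^ 'n) \<times> real) set \<Rightarrow> bool" where
  "hyp_convex \<kappa> C \<longleftrightarrow> C \<subseteq> hyp_space \<kappa> \<and> (\<forall>p\<in>C. \<forall>q\<in>C. geodesic_segment \<kappa> p q \<subseteq> C)"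

definition hyp_proj ::
    "real \<Rightarrow> ((real ^ 'n) \<times> real) set \<Rightarrow> (real ^ 'n) \<times> real \<Rightarrow> (real ^ 'n) \<times> real" where
  "hyp_proj \<kappa> C p = (THE q. is_arg_min (hyp_dist \<kappa> p) (\<lambda>q. q \<in> C) q)"

text \<open>
  The differential of \<open>f\<close> at \<open>p\<close> is the Frechet derivative of \<open>f\<close> within the embedded submanifold
  \<open>hyp_space \<kappa>\<close>. Such a derivative \<open>D\<close> is a linear map on the ambient space that only depends on the
  values of \<open>f\<close> on \<open>hyp_space \<kappa>\<close>; only its restriction to the tangent space is unique, and this
  restriction is the differential.
\<close>

definition has_hyp_grad ::
    "real \<Rightarrow> ((real ^ 'n) \<times> real \<Rightarrow> real) \<Rightarrow> (real ^ 'n) \<times> real \<Rightarrow> (real ^ 'n) \<times> real \<Rightarrow> bool" where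
  "has_hyp_grad \<kappa> f p g \<longleftrightarrow>
    g \<in> tangent_space p \<and>
    (\<exists>D. (f has_derivative D) (at p within hyp_space \<kappa>) \<and>
         (\<forall>v\<in>tangent_space p. D v = lorentz g v))"

definition hyp_grad ::
    "real \<Rightarrow> ((real ^ 'n) \<times> real \<Rightarrow> real) \<Rightarrow> (real ^ 'n) \<times> real \<Rightarrow> (real ^ 'n) \<times> real" where
  "hyp_grad \<kappa> f p = (THE g. has_hyp_grad \<kappa> f p g)"

text \<open>
  The stopping rule is not part of this predicate, which describes infinite runs;
  statements about such runs assume separately that the gradients do not vanish.
\<close>

definition grad_proj_backtracking ::
    "real \<Rightarrow> ((real ^ 'n) \<times> real) set \<Rightarrow> ((real ^ 'n) \<times> real \<Rightarrow> real) \<Rightarrow>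
     real \<Rightarrow> real \<Rightarrow> real \<Rightarrow> real \<Rightarrow> real \<Rightarrow> (nat \<Rightarrow> (real ^ 'n) \<times> real) \<Rightarrow> bool" where
  "grad_proj_backtracking \<kappa> C f \<rho> \<beta> \<theta>0 \<alpha>_min \<alpha>_max p \<longleftrightarrow>
    p 0 \<in> C \<and>
    (\<exists>\<alpha> \<theta> y z q L. \<theta> 0 = \<theta>0 \<and>
      (\<forall>k. \<alpha>_min \<le> \<alpha> k \<and> \<alpha> k \<le> \<alpha>_max \<and>
        y k = hyp_exp \<kappa> (p k) (- \<alpha> k *\<^sub>R hyp_grad \<kappa> f (p k)) \<and>
        z k = hyp_proj \<kappa> C (y k) \<and>
        q k = (\<lambda>\<tau>. hyp_exp \<kappa> (p k) (\<tau> *\<^sub>R hyp_log \<kappa> (p k) (z k))) \<and>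
        L k = (LEAST l::nat. l \<ge> 1 \<and>
                 f (q k (\<beta> ^ l * \<theta> k))
                 \<le> f (p k) + \<rho> * \<beta> ^ l * \<theta> k
                              * lorentz (hyp_grad \<kappa> f (p k)) (hyp_log \<kappa> (p k) (z k))) \<and>
        p (Suc k) = q k (\<beta> ^ L k * \<theta> k) \<and>
        \<theta> (Suc k) = \<beta> ^ (L k - 1) * \<theta> k))"

definition center_of_mass_fun ::
    "real \<Rightarrow> real \<Rightarrow> nat \<Rightarrow> (nat \<Rightarrow> real) \<Rightarrow> (nat \<Rightarrow> (real ^ 'n) \<times> real) \<Rightarrow> (real ^ 'n) \<times> real \<Rightarrow> real" where
  "center_of_mass_fun \<kappa> \<sigma> m \<mu> q p = (\<Sum>i=1..m. \<mu> i * hyp_dist \<kappa> p (q i) powr \<sigma>)"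

end

theory Submission
  imports Defs
begin

text \<open>
  In terms of \<open>s = cosh (sqrt \<kappa> * d(p, q\<^sub>i))\<close>, which is the restriction of a linear function of \<open>p\<close>,
  the objective is a sum of terms \<open>arcosh s powr \<sigma>\<close>, continuously differentiable on \<open>[1, \<infinity>)\<close> because
  \<open>\<sigma> \<ge> 2\<close>. Concavity of \<open>arcosh\<^sup>2\<close> turns the hyperbolic law of cosines into the CAT(0) inequality, and
  hence shows that the objective lies strictly above its tangents along geodesics.

  The sublevel sets are bounded, so a subsequence of the iterates, step sizes and projections converges.
  If the trial steps \<open>\<theta>\<^sub>k\<close> stay away from 0, the Armijo decrease forces the slopes
  \<open>\<langle>grad f(p\<^sub>k), log z\<^sub>k\<rangle>\<close> to 0; otherwise steps tending to 0 are rejected infinitely often, and the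
  limit slope along these rejections is nonnegative. The obtuse angle at the projection makes the slope
  negative unless \<open>z = p\<close>, so the limit point is stationary and is the strict minimizer. Since the
  objective values decrease, every other limit point has the same value and coincides with it.
\<close>

subsection \<open>The function arcosh and the hyperbolic law of cosines\<close>

text \<open>The value 1 at 0 is the continuous extension. Exponential and logarithm written with it
  need no case split at zero vectors or coinciding points, so they can be passed to limits
  there.\<close>

definition sinhc :: "real \<Rightarrow> real" where
  "sinhc x = (if x = 0 then 1 else sinh x / x)"

lemma sinhc_pos: "sinhc x > 0"
  by (cases "x > 0") (auto simp: sinhc_def zero_less_divide_iff)

lemma sinhc_minus [simp]: "sinhc (- x) = sinhc x"
  by (simp add: sinhc_def)

lemma mult_sinhc: "x * sinhc x = sinh x"
  by (simp add: sinhc_def)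

lemma isCont_sinhc: "isCont sinhc x"
proof (cases "x = 0")
  case True
  \<comment> \<open>The limit of sinh h / h at 0 is the derivative of sinh there.\<close>
  have "((\<lambda>h. (sinh (0 + h) - sinh 0) / h) \<longlongrightarrow> cosh (0::real)) (at 0)"
    using has_field_derivative_sinh[OF DERIV_ident, of 0 UNIV] unfolding DERIV_def by simp
  then have "((\<lambda>h. sinh h / h) \<longlongrightarrow> (1::real)) (at 0)" by simp
  moreover have "eventually (\<lambda>h::real. sinh h / h = sinhc h) (at 0)"
    by (auto simp: eventually_at sinhc_def intro!: exI[of _ 1])
  ultimately have "(sinhc \<longlongrightarrow> 1) (at 0)"
    using Lim_transform_eventually by blast
  then show ?thesis using True by (simp add: isCont_def sinhc_def)
next
  case False
  have "isCont (\<lambda>x. sinh x / x) x" using False by (intro continuous_intros) auto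
  moreover have "eventually (\<lambda>y. sinhc y = sinh y / y) (nhds x)"
    using False t1_space_nhds[of x 0] by (auto elim!: eventually_mono simp: sinhc_def)
  ultimately show ?thesis using isCont_cong[of sinhc "\<lambda>x. sinh x / x" x] by blast
qed

lemma tendsto_sinhc [tendsto_intros]: "(f \<longlongrightarrow> a) F \<Longrightarrow> ((\<lambda>x. sinhc (f x)) \<longlongrightarrow> sinhc a) F"
  by (rule isCont_tendsto_compose[OF isCont_sinhc])

lemma continuous_on_sinhc [continuous_intros]:
  "continuous_on A f \<Longrightarrow> continuous_on A (\<lambda>x. sinhc (f x))"
  by (rule continuous_on_compose2[of UNIV sinhc])
     (auto simp: continuous_on_eq_continuous_at isCont_sinhc)

text \<open>Since sinh is convex on the half-line and vanishes at 0, the slopes of its chords from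
  the origin increase. The endpoint \<open>x = 0\<close> follows by continuity from the
  right.\<close>

lemma sinhc_mono:
  assumes "0 \<le> x" "x \<le> y" shows "sinhc x \<le> sinhc y"
proof -
  have conv: "convex_on {0..} (sinh :: real \<Rightarrow> real)"
    by (rule convex_on_realI[where f' = cosh])
       (auto intro!: derivative_eq_intros simp: cosh_real_nonneg_le_iff)
  have *: "sinhc u \<le> sinhc v" if "0 < u" "u \<le> v" for u v
  proof -
    have "sinh u \<le> u / v * sinh v"
      using convex_onD[OF conv, of "u / v" 0 v] that by simp
    then show ?thesis using that by (simp add: sinhc_def field_simps)
  qed
  show ?thesis
  proof (cases "0 < x")
    case True then show ?thesis using * assms by blast
  next
    case False
    then have "x = 0" using assms by simp
    show ?thesis
    proof (cases "0 < y")
      case True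
      have "eventually (\<lambda>u. sinhc u \<le> sinhc y) (at_right 0)"
        using * True by (auto simp: eventually_at_right_field intro!: exI[of _ y])
      moreover have "(sinhc \<longlongrightarrow> sinhc 0) (at_right 0)"
        using isCont_sinhc isCont_def filterlim_at_split by blast
      ultimately show ?thesis
        using \<open>x = 0\<close> tendsto_upperbound[of sinhc "sinhc 0" "at_right 0" "sinhc y"] by simp
    qed (use assms \<open>x = 0\<close> in auto)
  qed
qed

section \<open>Calculus of powers of arcosh up to the endpoint 1\<close>

lemma sinhc_arcosh: "s > 1 \<Longrightarrow> sinhc (arcosh s) = sqrt (s\<^sup>2 - 1) / arcosh s"
  by (simp add: sinhc_def sinh_arcosh_real)

text \<open>The derivative of \<open>arcosh s powr \<sigma>\<close>, in a form that stays correct at \<open>s = 1\<close>; the case split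
  avoids \<open>0 powr 0 = 0\<close>.\<close>

definition arcosh_powr_deriv :: "real \<Rightarrow> real \<Rightarrow> real" where
  "arcosh_powr_deriv \<sigma> s =
    \<sigma> * (if \<sigma> = 2 then 1 else arcosh s powr (\<sigma> - 2)) / sinhc (arcosh s)"

lemma continuous_on_arcosh_powr:
  "0 < \<sigma> \<Longrightarrow> continuous_on {1::real..} (\<lambda>s. arcosh s powr \<sigma>)"
  by (rule continuous_on_powr') (auto intro!: continuous_intros)

lemma continuous_on_arcosh_powr_deriv:
  assumes "\<sigma> \<ge> 2" shows "continuous_on {1..} (arcosh_powr_deriv \<sigma>)"
proof (cases "\<sigma> = 2")
  case True
  then show ?thesis unfolding arcosh_powr_deriv_def
    by (auto intro!: continuous_intros simp: sinhc_pos less_imp_neq[OF sinhc_pos, symmetric])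
next
  case False
  then show ?thesis using assms unfolding arcosh_powr_deriv_def
    by (auto intro!: continuous_intros continuous_on_powr' simp: less_imp_neq[OF sinhc_pos, symmetric])
qed

lemma arcosh_powr_has_derivative:
  assumes "s > 1"
  shows "((\<lambda>s. arcosh s powr \<sigma>) has_real_derivative arcosh_powr_deriv \<sigma> s) (at s)"
proof -
  have pos: "arcosh s > 0" using assms by (simp add: less_imp_neq)
  have "arcosh s * (if \<sigma> = 2 then 1 else arcosh s powr (\<sigma> - 2)) = arcosh s powr (\<sigma> - 1)"
  proof (cases "\<sigma> = 2")
    case False
    have "arcosh s * arcosh s powr (\<sigma> - 2) = arcosh s powr (1 + (\<sigma> - 2))"
      using pos by (subst powr_add) simp
    then show ?thesis using False by (simp add: algebra_simps)
  qed (use pos in simp)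
  then have "arcosh_powr_deriv \<sigma> s = \<sigma> * arcosh s powr (\<sigma> - 1) * (1 / sqrt (s\<^sup>2 - 1))"
    using assms unfolding arcosh_powr_deriv_def sinhc_arcosh[OF assms]
    by (simp add: mult.assoc mult.commute[of _ "arcosh s"])
  moreover have "((\<lambda>s. arcosh s powr \<sigma>) has_real_derivative
      (\<sigma> * arcosh s powr (\<sigma> - 1) * (1 / sqrt (s\<^sup>2 - 1)))) (at s)"
    using DERIV_chain2[OF has_real_derivative_powr[OF pos] arcosh_real_has_field_derivative[OF assms]] .
  ultimately show ?thesis by simp
qed

text \<open>The mean value theorem differentiates only inside the interval, so the point 1, where
  arcosh has a vertical tangent, may be an endpoint.\<close>

lemma arcosh_powr_mvt:
  assumes "\<sigma> > 0" "1 \<le> s" "1 \<le> t"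
  obtains \<xi> where "\<xi> \<ge> 1" "min s t \<le> \<xi>" "\<xi> \<le> max s t"
    "arcosh t powr \<sigma> - arcosh s powr \<sigma> = arcosh_powr_deriv \<sigma> \<xi> * (t - s)"
proof -
  let ?G = "\<lambda>s. arcosh s powr \<sigma>"
  have *: "\<exists>\<xi>. a < \<xi> \<and> \<xi> < b \<and> ?G b - ?G a = (b - a) * arcosh_powr_deriv \<sigma> \<xi>"
    if ab: "1 \<le> a" "a < b" for a b
  proof -
    have "continuous_on {a..b} ?G"
      using continuous_on_arcosh_powr[OF assms(1)] by (rule continuous_on_subset) (use ab in auto)
    then obtain l \<xi> where \<xi>: "a < \<xi>" "\<xi> < b" "(?G has_real_derivative l) (at \<xi>)"
      "?G b - ?G a = (b - a) * l"
      using MVT[OF ab(2), of ?G] arcosh_powr_has_derivative[of _ \<sigma>] ab(1)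
      by (auto simp: real_differentiable_def) (meson le_less_trans)
    then have "l = arcosh_powr_deriv \<sigma> \<xi>"
      using arcosh_powr_has_derivative[of \<xi> \<sigma>] ab by (intro DERIV_unique[OF \<xi>(3)]) auto
    with \<xi> show ?thesis by blast
  qed
  show ?thesis
  proof (cases s t rule: linorder_cases)
    case less
    with *[of s t] assms obtain \<xi> where "s < \<xi>" "\<xi> < t" "?G t - ?G s = (t - s) * arcosh_powr_deriv \<sigma> \<xi>"
      by blast
    then show ?thesis using that[of \<xi>] assms less by (simp add: mult.commute)
  next
    case equal
    then show ?thesis using that[of s] assms by simp
  next
    case greater
    with *[of t s] assms obtain \<xi> where "t < \<xi>" "\<xi> < s" "?G s - ?G t = (s - t) * arcosh_powr_deriv \<sigma> \<xi>"
      by blast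
    then show ?thesis using that[of \<xi>] assms greater by (simp add: algebra_simps)
  qed
qed

text \<open>The base points \<open>s k\<close> move too, as the iterates do later, so
  differentiability at \<open>a\<close> alone would not suffice. The mean value points are squeezed
  to \<open>a\<close>, and the derivative is continuous on all of \<open>{1..}\<close>.\<close>

lemma tendsto_arcosh_powr_difference_quotient:
  assumes "\<sigma> \<ge> 2" and s: "\<And>k. s k \<ge> 1" and t: "\<And>k. t k \<ge> 1"
    and lims: "s \<longlonglongrightarrow> a" "t \<longlonglongrightarrow> a" and quot: "(\<lambda>k. (t k - s k) / \<tau> k) \<longlonglongrightarrow> b"
  shows "(\<lambda>k. (arcosh (t k) powr \<sigma> - arcosh (s k) powr \<sigma>) / \<tau> k)
           \<longlonglongrightarrow> arcosh_powr_deriv \<sigma> a * b"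
proof -
  have "\<exists>\<xi>. \<xi> \<ge> 1 \<and> min (s k) (t k) \<le> \<xi> \<and> \<xi> \<le> max (s k) (t k) \<and>
    arcosh (t k) powr \<sigma> - arcosh (s k) powr \<sigma> = arcosh_powr_deriv \<sigma> \<xi> * (t k - s k)" for k
  proof (rule arcosh_powr_mvt[of \<sigma> "s k" "t k"])
    show "0 < \<sigma>" using assms(1) by simp
  qed (use s t in blast)+
  then obtain \<xi> where \<xi>: "\<And>k. \<xi> k \<ge> 1" "\<And>k. min (s k) (t k) \<le> \<xi> k" "\<And>k. \<xi> k \<le> max (s k) (t k)"
    "\<And>k. arcosh (t k) powr \<sigma> - arcosh (s k) powr \<sigma> = arcosh_powr_deriv \<sigma> (\<xi> k) * (t k - s k)"
    by metis
  have "(\<lambda>k. min (s k) (t k)) \<longlonglongrightarrow> min a a" "(\<lambda>k. max (s k) (t k)) \<longlonglongrightarrow> max a a"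
    by (intro tendsto_min tendsto_max lims)+
  then have "\<xi> \<longlonglongrightarrow> a"
    using \<xi>(2,3) tendsto_sandwich[of "\<lambda>k. min (s k) (t k)" \<xi> sequentially "\<lambda>k. max (s k) (t k)" a]
    by simp
  moreover have "a \<ge> 1" using s by (intro LIMSEQ_le_const[OF lims(1)]) auto
  ultimately have "(\<lambda>k. arcosh_powr_deriv \<sigma> (\<xi> k)) \<longlonglongrightarrow> arcosh_powr_deriv \<sigma> a"
    by (intro continuous_on_tendsto_compose[OF continuous_on_arcosh_powr_deriv[OF assms(1)]])
       (auto simp: \<xi>(1))
  from tendsto_mult[OF this quot] show ?thesis by (simp add: \<xi>(4))
qed

lemma arcosh_powr_has_derivative_within:
  assumes "\<sigma> \<ge> 2" "s \<ge> 1"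
  shows "((\<lambda>s. arcosh s powr \<sigma>) has_real_derivative arcosh_powr_deriv \<sigma> s) (at s within {1..})"
  unfolding has_field_derivative_iff tendsto_at_iff_sequentially comp_def
proof safe
  fix X assume X: "\<forall>i. X i \<in> {1..} - {s}" "X \<longlonglongrightarrow> s"
  have "(\<lambda>k. (X k - s) / (X k - s)) \<longlonglongrightarrow> 1" using X(1) by simp
  from tendsto_arcosh_powr_difference_quotient[OF assms(1) _ _ tendsto_const X(2) this] X(1) assms
  show "(\<lambda>k. (arcosh (X k) powr \<sigma> - arcosh s powr \<sigma>) / (X k - s)) \<longlonglongrightarrow> arcosh_powr_deriv \<sigma> s"
    by simp
qed

lemma arcosh_powr2: "(s::real) \<ge> 1 \<Longrightarrow> arcosh s powr 2 = (arcosh s)\<^sup>2"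
  by (cases "s = 1") auto

text \<open>The derivative \<open>2 / sinhc (arcosh s)\<close> decreases because
  \<open>sinhc\<close> increases: \<open>arcosh\<^sup>2\<close> is concave on \<open>{1..}\<close>,
  endpoint included.\<close>

lemma arcosh_square_le_tangent:
  assumes "1 \<le> s" "1 \<le> t"
  shows "(arcosh t)\<^sup>2 \<le> (arcosh s)\<^sup>2 + 2 / sinhc (arcosh s) * (t - s)"
proof -
  obtain \<xi> where \<xi>: "\<xi> \<ge> 1" "min s t \<le> \<xi>" "\<xi> \<le> max s t"
    "arcosh t powr 2 - arcosh s powr 2 = arcosh_powr_deriv 2 \<xi> * (t - s)"
    using arcosh_powr_mvt[of 2 s t] assms by auto
  have mono: "2 / sinhc (arcosh y) \<le> 2 / sinhc (arcosh x)" if "1 \<le> x" "x \<le> y" for x y :: real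
  proof -
    have "arcosh x \<le> arcosh y" using that by (metis arcosh_real_strict_mono less_eq_real_def)
    then show ?thesis using that sinhc_mono[of "arcosh x" "arcosh y"] sinhc_pos
      by (intro divide_left_mono mult_pos_pos) auto
  qed
  have "2 / sinhc (arcosh \<xi>) * (t - s) \<le> 2 / sinhc (arcosh s) * (t - s)"
  proof (cases "s \<le> t")
    case True then show ?thesis using mono[of s \<xi>] \<xi> assms by (intro mult_right_mono) auto
  next
    case False then show ?thesis using mono[of \<xi> s] \<xi> assms by (intro mult_right_mono_neg) auto
  qed
  with \<xi>(4) show ?thesis using assms by (simp add: arcosh_powr2 arcosh_powr_deriv_def)
qed

text \<open>The comparison with the Euclidean law of cosines: as functions of \<open>w\<close>, the left side is affine and
  the right side is concave, and both agree at \<open>w = \<plusminus>1\<close>.\<close>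

lemma hyperbolic_law_of_cosines_le:
  fixes d D w :: real
  assumes "\<bar>w\<bar> \<le> 1"
  shows "1 \<le> cosh d * cosh D - sinh d * sinh D * w"
    and "d\<^sup>2 + D\<^sup>2 - 2 * d * D * w \<le> (arcosh (cosh d * cosh D - sinh d * sinh D * w))\<^sup>2"
proof -
  define s where "s = cosh d * cosh D - sinh d * sinh D * w"
  \<comment> \<open>For w = 1 and w = -1 the triangle degenerates, with third side of length |d - D|
    or d + D. The weights write \<open>w\<close> as a convex combination of these two cases.\<close>
  have s: "s = (1 + w) / 2 * cosh (d - D) + (1 - w) / 2 * cosh (d + D)"
    by (simp add: s_def cosh_add cosh_diff field_simps)
  have w: "(1 + w) / 2 \<ge> 0" "(1 - w) / 2 \<ge> 0" using assms by auto
  have "s \<ge> (1 + w) / 2 * 1 + (1 - w) / 2 * 1" unfolding s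
    using w cosh_real_ge_1 by (intro add_mono mult_left_mono) auto
  then have s1: "s \<ge> 1" by (simp add: field_simps)
  have sq: "(arcosh (cosh x))\<^sup>2 = x\<^sup>2" for x :: real
    using arcosh_cosh_real[of "\<bar>x\<bar>"] by simp
  define c where "c = 2 / sinhc (arcosh s)"
  \<comment> \<open>Jensen's inequality for the concave \<open>arcosh\<^sup>2\<close>: average the
    tangent bounds at \<open>s\<close>, whose linear terms cancel.\<close>
  have "(1 + w) / 2 * (d - D)\<^sup>2 + (1 - w) / 2 * (d + D)\<^sup>2 \<le>
     (1 + w) / 2 * ((arcosh s)\<^sup>2 + c * (cosh (d - D) - s)) + (1 - w) / 2 * ((arcosh s)\<^sup>2 + c * (cosh (d + D) - s))"
    using w arcosh_square_le_tangent[OF s1, of "cosh (d - D)"]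
      arcosh_square_le_tangent[OF s1, of "cosh (d + D)"]
    by (intro add_mono mult_left_mono) (auto simp: sq c_def cosh_real_ge_1)
  also have "\<dots> = (arcosh s)\<^sup>2 + c * ((1 + w) / 2 * cosh (d - D) + (1 - w) / 2 * cosh (d + D) - s)"
    by (simp add: field_simps)
  also have "\<dots> = (arcosh s)\<^sup>2" unfolding s[symmetric] by simp
  finally show "d\<^sup>2 + D\<^sup>2 - 2 * d * D * w \<le> (arcosh (cosh d * cosh D - sinh d * sinh D * w))\<^sup>2"
    unfolding s_def by (simp add: power2_eq_square field_simps)
  show "1 \<le> cosh d * cosh D - sinh d * sinh D * w" using s1 unfolding s_def .
qed

text \<open>Convexity of the power function on the open half-line gives the case
  \<open>y > 0\<close>. At \<open>y = 0\<close> the left side is (1 - a) times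
  \<open>x powr a\<close>, hence at most 0.\<close>

lemma powr_ge_tangent:
  fixes x y a :: real
  assumes "a \<ge> 1" "x > 0" "y \<ge> 0"
  shows "x powr a + a * x powr (a - 1) * (y - x) \<le> y powr a"
proof (cases "y = 0")
  case True
  have "x powr a = x * x powr (a - 1)" using assms by (simp add: powr_mult_base)
  moreover have "1 * (x * x powr (a - 1)) \<le> a * (x * x powr (a - 1))"
    using assms by (intro mult_right_mono) auto
  ultimately show ?thesis using True by (simp add: algebra_simps)
next
  case False
  have "((\<lambda>x. x powr a) has_real_derivative a * x powr (a - 1)) (at x within {0<..})"
    using assms by (auto intro!: derivative_eq_intros simp: powr_diff field_simps)
  from convex_on_imp_above_tangent[OF powr_convex[OF assms(1)] _ _ _ this, of y]
  show ?thesis using assms False by (auto simp: interior_open algebra_simps)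
qed

lemma square_powr_half: "x \<ge> 0 \<Longrightarrow> (x\<^sup>2) powr (a / 2) = (x::real) powr a"
  by (cases "x = 0") (auto simp: powr_powr simp flip: powr_numeral)

text \<open>Here \<open>d\<close> and \<open>D\<close> are two sides of a triangle, \<open>w\<close>
  the cosine of the angle between them, and \<open>t\<close> the cosh of the third side. The CAT(0)
  bound is composed with the increasing convex function u powr (\<sigma>/2); the surplus
  \<open>D\<^sup>2\<close> makes the inequality strict. The case \<open>d = 0\<close> is separate
  because the tangent of that power is taken at a positive point.\<close>

lemma arcosh_powr_above_tangent:
  fixes d D w :: real
  assumes "\<sigma> \<ge> 2" "d \<ge> 0" "D > 0" "\<bar>w\<bar> \<le> 1"
  defines "t \<equiv> cosh d * cosh D - sinh d * sinh D * w"
  shows "d powr \<sigma> - arcosh_powr_deriv \<sigma> (cosh d) * (D * sinh d * w) < arcosh t powr \<sigma>"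
proof -
  have t1: "t \<ge> 1" and law: "d\<^sup>2 + D\<^sup>2 - 2 * d * D * w \<le> (arcosh t)\<^sup>2"
    unfolding t_def by (rule hyperbolic_law_of_cosines_le, fact)+
  show ?thesis
  proof (cases "d = 0")
    case True
    then have "t = cosh D" by (simp add: t_def)
    then show ?thesis using True assms by (simp add: arcosh_cosh_real)
  next
    case False
    \<comment> \<open>The derivative of u powr (\<sigma>/2) at u = \<open>d\<^sup>2\<close>; the
      next claims express the chain rule for d powr \<sigma>.\<close>
    define P where "P = \<sigma> / 2 * (d\<^sup>2) powr (\<sigma> / 2 - 1)"
    have "P > 0" using assms False by (simp add: P_def)
    have ds: "d > 0" using False assms by simp
    have P: "arcosh_powr_deriv \<sigma> (cosh d) * sinh d = 2 * P * d"
    proof -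
      have "(d\<^sup>2) powr (\<sigma> / 2 - 1) = (d\<^sup>2) powr ((\<sigma> - 2) / 2)" by (simp add: diff_divide_distrib)
      also have "\<dots> = d powr (\<sigma> - 2)" using ds by (subst square_powr_half) auto
      finally have "(d\<^sup>2) powr (\<sigma> / 2 - 1) = d powr (\<sigma> - 2)" .
      then show ?thesis using ds
        by (simp add: arcosh_powr_deriv_def arcosh_cosh_real P_def sinhc_def)
    qed
    have "d powr \<sigma> - arcosh_powr_deriv \<sigma> (cosh d) * (D * sinh d * w)
        = d powr \<sigma> - (arcosh_powr_deriv \<sigma> (cosh d) * sinh d) * (D * w)" by simp
    also have "\<dots> = d powr \<sigma> + P * (- 2 * d * D * w)" unfolding P by simp
    also have "\<dots> < d powr \<sigma> + P * ((arcosh t)\<^sup>2 - d\<^sup>2)"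
      using law zero_less_power[OF assms(3), of 2] \<open>P > 0\<close>
      by (intro add_strict_left_mono mult_strict_left_mono) linarith+
    also have "\<dots> = (d\<^sup>2) powr (\<sigma> / 2) + \<sigma> / 2 * (d\<^sup>2) powr (\<sigma> / 2 - 1) * ((arcosh t)\<^sup>2 - d\<^sup>2)"
      using ds by (simp add: P_def square_powr_half)
    also have "\<dots> \<le> ((arcosh t)\<^sup>2) powr (\<sigma> / 2)"
      using assms ds by (intro powr_ge_tangent) auto
    also have "\<dots> = arcosh t powr \<sigma>" using t1 by (simp add: square_powr_half)
    finally show ?thesis .
  qed
qed

subsection \<open>The hyperboloid model\<close>

lemma lorentz_eq_inner: "lorentz x y = fst x \<bullet> fst y - snd x * snd y"
  by (simp add: lorentz_def inner_vec_def)

text \<open>Flipping the sign of one last coordinate turns the form into the Euclidean inner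
  product; this yields its algebraic and limit rules.\<close>

interpretation lorentz: bounded_bilinear "lorentz :: (real ^ 'n) \<times> real \<Rightarrow> _"
proof -
  have "bounded_linear (\<lambda>x::(real ^ 'n) \<times> real. (fst x, - snd x))"
    by (intro bounded_linear_Pair bounded_linear_minus bounded_linear_fst bounded_linear_snd)
  then have "bounded_bilinear (\<lambda>x y::(real ^ 'n) \<times> real. inner (fst x, - snd x) y)"
    by (rule bounded_bilinear.comp1[OF bounded_bilinear_inner])
  moreover have "(\<lambda>x y::(real ^ 'n) \<times> real. inner (fst x, - snd x) y) = lorentz"
    by (auto simp: fun_eq_iff lorentz_eq_inner)
  ultimately show "bounded_bilinear (lorentz :: (real ^ 'n) \<times> real \<Rightarrow> _)" by simp
qed

lemma lorentz_commute: "lorentz x y = lorentz y x"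
  by (simp add: lorentz_eq_inner inner_commute mult.commute)

text \<open>On \<open>hyp_space \<kappa>\<close> this is \<open>cosh (sqrt \<kappa> * hyp_dist \<kappa> x y)\<close>, but unlike the distance it is bilinear on the
  whole ambient space.\<close>

definition hcosh :: "real \<Rightarrow> (real ^ 'n) \<times> real \<Rightarrow> (real ^ 'n) \<times> real \<Rightarrow> real" where
  "hcosh \<kappa> x y = - \<kappa> * lorentz x y"

interpretation hcosh: bounded_bilinear "hcosh \<kappa> :: (real ^ 'n) \<times> real \<Rightarrow> _" for \<kappa>
proof -
  have "bounded_bilinear (\<lambda>x. lorentz ((- \<kappa>) *\<^sub>R x :: (real ^ 'n) \<times> real))"
    by (rule bounded_bilinear.comp1[OF lorentz.bounded_bilinear_axioms bounded_linear_scaleR_right])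
  moreover have "(\<lambda>x. lorentz ((- \<kappa>) *\<^sub>R x :: (real ^ 'n) \<times> real)) = hcosh \<kappa>"
    by (auto simp: fun_eq_iff hcosh_def lorentz.scaleR_left lorentz.minus_left)
  ultimately show "bounded_bilinear (hcosh \<kappa> :: (real ^ 'n) \<times> real \<Rightarrow> _)" by simp
qed

lemma hcosh_commute: "hcosh \<kappa> x y = hcosh \<kappa> y x"
  by (simp add: hcosh_def lorentz_commute)

text \<open>Orthogonality equates the product of the time parts with the inner product of the space
  parts. By Cauchy-Schwarz, two vectors with dominant time parts can satisfy this only if the second
  vanishes, because the first is strictly timelike.\<close>

lemma lorentz_pos_of_orthogonal:
  assumes "lorentz p p < 0" "lorentz p v = 0" "v \<noteq> 0"
  shows "lorentz v v > 0"
proof (rule ccontr)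
  assume "\<not> lorentz v v > 0"
  then have v: "(norm (fst v))\<^sup>2 \<le> (snd v)\<^sup>2"
    by (simp add: lorentz_eq_inner power2_norm_eq_inner flip: power2_eq_square)
  have p: "(norm (fst p))\<^sup>2 < (snd p)\<^sup>2"
    using assms(1) by (simp add: lorentz_eq_inner power2_norm_eq_inner flip: power2_eq_square)
  have "(snd p)\<^sup>2 * (snd v)\<^sup>2 = (fst p \<bullet> fst v)\<^sup>2"
    using assms(2) by (simp add: lorentz_eq_inner power_mult_distrib)
  also have "\<dots> \<le> (norm (fst p))\<^sup>2 * (norm (fst v))\<^sup>2"
    using Cauchy_Schwarz_ineq by (simp add: power2_norm_eq_inner)
  also have "\<dots> \<le> (norm (fst p))\<^sup>2 * (snd v)\<^sup>2"
    using v by (intro mult_left_mono) auto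
  finally have "((snd p)\<^sup>2 - (norm (fst p))\<^sup>2) * (snd v)\<^sup>2 \<le> 0"
    by (simp add: algebra_simps)
  then have "snd v = 0" using p by (auto simp: mult_le_0_iff)
  then have "fst v = 0" using v by simp
  with \<open>snd v = 0\<close> assms(3) show False by (simp add: prod_eq_iff)
qed

lemma mem_hyp_space_iff:
  "\<kappa> > 0 \<Longrightarrow> p \<in> hyp_space \<kappa> \<longleftrightarrow> hcosh \<kappa> p p = 1 \<and> snd p > 0"
  by (auto simp: hyp_space_def hcosh_def field_simps)

lemma snd_nonzero_if_hcosh_pos:
  assumes "\<kappa> > 0" "hcosh \<kappa> x x > 0" shows "snd x \<noteq> 0"
proof
  assume "snd x = 0"
  then have "hcosh \<kappa> x x \<le> 0"
    using assms(1) by (simp add: hcosh_def lorentz_eq_inner)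
  with assms(2) show False by simp
qed

lemma hyp_space_lorentz_neg: "\<kappa> > 0 \<Longrightarrow> p \<in> hyp_space \<kappa> \<Longrightarrow> lorentz p p < 0"
  by (simp add: hyp_space_def)

lemma hyp_space_norm_fst_less:
  assumes "\<kappa> > 0" "p \<in> hyp_space \<kappa>" shows "norm (fst p) < snd p"
proof -
  have "(norm (fst p))\<^sup>2 < (snd p)\<^sup>2"
    using hyp_space_lorentz_neg[OF assms]
    by (simp add: lorentz_eq_inner power2_norm_eq_inner flip: power2_eq_square)
  then show ?thesis using assms by (auto simp: hyp_space_def intro: power2_less_imp_less)
qed

text \<open>Cauchy-Schwarz in the space coordinates and \<open>norm (fst p) < snd p\<close>. For
  \<open>q\<close> on the hyperboloid the left factor is positive, which gives both the sign of
  \<open>hcosh\<close> and a bound on \<open>snd p\<close>.\<close>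

lemma snd_le_hcosh:
  assumes "\<kappa> > 0" "p \<in> hyp_space \<kappa>"
  shows "\<kappa> * snd p * (snd q - norm (fst q)) \<le> hcosh \<kappa> p q"
proof -
  have "fst p \<bullet> fst q \<le> norm (fst p) * norm (fst q)" by (rule norm_cauchy_schwarz)
  also have "\<dots> \<le> snd p * norm (fst q)"
    using hyp_space_norm_fst_less[OF assms] by (intro mult_right_mono) auto
  finally have "\<kappa> * (snd p * snd q - snd p * norm (fst q)) \<le> \<kappa> * (snd p * snd q - fst p \<bullet> fst q)"
    using assms(1) by (intro mult_left_mono) auto
  then show ?thesis by (simp add: hcosh_def lorentz_eq_inner algebra_simps)
qed

lemma hcosh_pos:
  assumes "\<kappa> > 0" "p \<in> hyp_space \<kappa>" "q \<in> hyp_space \<kappa>" shows "hcosh \<kappa> p q > 0"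
proof -
  have "0 < \<kappa> * snd p * (snd q - norm (fst q))"
    using assms hyp_space_norm_fst_less[OF assms(1,3)]
    by (intro mult_pos_pos) (auto simp: hyp_space_def)
  also have "\<dots> \<le> hcosh \<kappa> p q" by (rule snd_le_hcosh) fact+
  finally show ?thesis .
qed

lemma mem_tangent_space_iff: "\<kappa> > 0 \<Longrightarrow> v \<in> tangent_space p \<longleftrightarrow> hcosh \<kappa> p v = 0"
  by (simp add: tangent_space_def hcosh_def)

lemma tangent_space_scaleR: "v \<in> tangent_space p \<Longrightarrow> t *\<^sub>R v \<in> tangent_space p"
  by (simp add: tangent_space_def lorentz.scaleR_right)

lemma lorentz_tangent_nonneg:
  assumes "\<kappa> > 0" "p \<in> hyp_space \<kappa>" "v \<in> tangent_space p"
  shows "lorentz v v \<ge> 0"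
  using lorentz_pos_of_orthogonal[OF hyp_space_lorentz_neg[OF assms(1,2)], of v] assms(3)
  by (cases "v = 0") (auto simp: tangent_space_def lorentz.zero_left)

lemma lorentz_tangent_eq_0:
  assumes "\<kappa> > 0" "p \<in> hyp_space \<kappa>" "v \<in> tangent_space p" "lorentz v v = 0"
  shows "v = 0"
  using lorentz_pos_of_orthogonal[OF hyp_space_lorentz_neg[OF assms(1,2)], of v] assms(3,4)
  by (auto simp: tangent_space_def)

lemma lorentz_tangent_Cauchy_Schwarz:
  assumes "\<kappa> > 0" "p \<in> hyp_space \<kappa>" "u \<in> tangent_space p" "v \<in> tangent_space p"
  shows "(lorentz u v)\<^sup>2 \<le> lorentz u u * lorentz v v"
proof (cases "v = 0")
  case False
  \<comment> \<open>A multiple of the component of \<open>u\<close> orthogonal to \<open>v\<close>;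
    its square is nonnegative.\<close>
  let ?w = "lorentz v v *\<^sub>R u - lorentz u v *\<^sub>R v"
  have v: "lorentz v v > 0"
    using lorentz_tangent_nonneg[OF assms(1,2,4)] lorentz_tangent_eq_0[OF assms(1,2,4)] False
    by fastforce
  have "?w \<in> tangent_space p"
    using assms(3,4) by (simp add: tangent_space_def lorentz.diff_right lorentz.scaleR_right)
  then have "0 \<le> lorentz ?w ?w" by (rule lorentz_tangent_nonneg[OF assms(1,2)])
  also have "\<dots> = lorentz v v * (lorentz u u * lorentz v v - (lorentz u v)\<^sup>2)"
    using lorentz_commute[of v u]
    by (simp add: lorentz.diff_right lorentz.scaleR_right lorentz.diff_left lorentz.scaleR_left
        algebra_simps power2_eq_square)
  finally show ?thesis using v by (simp add: zero_le_mult_iff)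
qed (simp add: lorentz.zero_right)

text \<open>The vector \<open>w\<close> is the projection of \<open>q\<close> to the tangent space
  at \<open>p\<close>, and the second identity is sinh squared = cosh squared - 1 for the scaled
  distance.\<close>

lemma hcosh_orthogonal_part:
  assumes "\<kappa> > 0" "p \<in> hyp_space \<kappa>" "q \<in> hyp_space \<kappa>"
  defines "w \<equiv> q - hcosh \<kappa> p q *\<^sub>R p"
  shows "w \<in> tangent_space p" "\<kappa> * lorentz w w = (hcosh \<kappa> p q)\<^sup>2 - 1"
proof -
  have 1: "hcosh \<kappa> p p = 1" "hcosh \<kappa> q q = 1" using assms(1-3) by (auto simp: mem_hyp_space_iff)
  show "w \<in> tangent_space p" using 1 assms(1)
    by (simp add: mem_tangent_space_iff w_def hcosh.diff_right hcosh.scaleR_right)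
  have "\<kappa> * lorentz w w = - hcosh \<kappa> w w" by (simp add: hcosh_def)
  also have "\<dots> = (hcosh \<kappa> p q)\<^sup>2 - 1" using 1 hcosh_commute[of \<kappa> q p]
    by (simp add: w_def hcosh.diff_right hcosh.scaleR_right hcosh.diff_left hcosh.scaleR_left
        power2_eq_square)
  finally show "\<kappa> * lorentz w w = (hcosh \<kappa> p q)\<^sup>2 - 1" .
qed

lemma hcosh_ge_1:
  assumes "\<kappa> > 0" "p \<in> hyp_space \<kappa>" "q \<in> hyp_space \<kappa>" shows "hcosh \<kappa> p q \<ge> 1"
proof -
  have "0 \<le> (hcosh \<kappa> p q)\<^sup>2 - 1"
    using hcosh_orthogonal_part[OF assms] lorentz_tangent_nonneg[OF assms(1,2)] assms(1)
    by (metis less_imp_le mult_nonneg_nonneg)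
  then have "1\<^sup>2 \<le> (hcosh \<kappa> p q)\<^sup>2" by simp
  then show ?thesis using hcosh_pos[OF assms] power2_le_imp_le[of 1 "hcosh \<kappa> p q"] by simp
qed

lemma hcosh_eq_1_iff:
  assumes "\<kappa> > 0" "p \<in> hyp_space \<kappa>" "q \<in> hyp_space \<kappa>" shows "hcosh \<kappa> p q = 1 \<longleftrightarrow> p = q"
proof
  assume 1: "hcosh \<kappa> p q = 1"
  then have "q - hcosh \<kappa> p q *\<^sub>R p = 0"
    using hcosh_orthogonal_part[OF assms] assms(1) by (intro lorentz_tangent_eq_0[OF assms(1,2)]) auto
  with 1 show "p = q" by simp
qed (use assms in \<open>simp add: mem_hyp_space_iff\<close>)

section \<open>Distance, exponential map and logarithm\<close>

lemma hyp_dist_eq: "hyp_dist \<kappa> p q = arcosh (hcosh \<kappa> p q) / sqrt \<kappa>"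
  by (simp add: hyp_dist_def hcosh_def)

lemma hyp_dist_less_iff:
  assumes "\<kappa> > 0" "hcosh \<kappa> p q \<ge> 1" "hcosh \<kappa> p' q' \<ge> 1"
  shows "hyp_dist \<kappa> p q < hyp_dist \<kappa> p' q' \<longleftrightarrow> hcosh \<kappa> p q < hcosh \<kappa> p' q'"
  using assms by (simp add: hyp_dist_eq divide_less_cancel)

lemma lorentz_norm_square:
  assumes "\<kappa> > 0" "p \<in> hyp_space \<kappa>" "v \<in> tangent_space p"
  shows "(sqrt \<kappa> * lorentz_norm v)\<^sup>2 = - hcosh \<kappa> v v"
  using assms lorentz_tangent_nonneg[OF assms]
  by (simp add: lorentz_norm_def hcosh_def power_mult_distrib)

lemma lorentz_norm_scaleR: "lorentz_norm (t *\<^sub>R v) = \<bar>t\<bar> * lorentz_norm v"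
  by (simp add: lorentz_norm_def lorentz.scaleR_left lorentz.scaleR_right real_sqrt_mult
      flip: mult.assoc)

lemma hyp_exp_scaleR:
  fixes v :: "(real ^ 'n) \<times> real"
  assumes "\<kappa> > 0" "p \<in> hyp_space \<kappa>" "v \<in> tangent_space p"
  defines "\<delta> \<equiv> sqrt \<kappa> * lorentz_norm v"
  shows "hyp_exp \<kappa> p (t *\<^sub>R v) = cosh (t * \<delta>) *\<^sub>R p + (t * sinhc (t * \<delta>)) *\<^sub>R v"
proof (cases "t = 0 \<or> v = 0")
  case False
  then have "lorentz_norm v \<noteq> 0"
    using lorentz_tangent_eq_0[OF assms(1-3)] by (auto simp: lorentz_norm_def)
  moreover have "cosh (\<bar>t\<bar> * \<delta>) = cosh (t * \<delta>)" "sinhc (\<bar>t\<bar> * \<delta>) = sinhc (t * \<delta>)"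
    by (auto simp: abs_if)
  moreover have "sqrt \<kappa> * lorentz_norm (t *\<^sub>R v) = \<bar>t\<bar> * \<delta>"
    by (simp add: lorentz_norm_scaleR \<delta>_def)
  moreover have "\<bar>t\<bar> * \<delta> \<noteq> 0" using False calculation(1) assms(1) by (simp add: \<delta>_def)
  then have "sinh (\<bar>t\<bar> * \<delta>) / (\<bar>t\<bar> * \<delta>) = sinhc (\<bar>t\<bar> * \<delta>)" by (simp add: sinhc_def)
  ultimately show ?thesis
    using False by (simp add: hyp_exp_def mult.commute)
next
  case True
  then have "t * \<delta> = 0" by (auto simp: \<delta>_def lorentz_norm_def lorentz.zero_left)
  with True show ?thesis by (auto simp: hyp_exp_def)
qed

lemma hyp_exp_eq:
  fixes v :: "(real ^ 'n) \<times> real"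
  assumes "\<kappa> > 0" "p \<in> hyp_space \<kappa>" "v \<in> tangent_space p"
  shows "hyp_exp \<kappa> p v = cosh (sqrt \<kappa> * lorentz_norm v) *\<^sub>R p + sinhc (sqrt \<kappa> * lorentz_norm v) *\<^sub>R v"
  using hyp_exp_scaleR[OF assms, of 1] by simp

lemma hcosh_hyp_exp_scaleR:
  fixes v :: "(real ^ 'n) \<times> real"
  assumes "\<kappa> > 0" "p \<in> hyp_space \<kappa>" "v \<in> tangent_space p"
  defines "\<delta> \<equiv> sqrt \<kappa> * lorentz_norm v"
  shows "hcosh \<kappa> (hyp_exp \<kappa> p (t *\<^sub>R v)) y
    = cosh (t * \<delta>) * hcosh \<kappa> p y + t * sinhc (t * \<delta>) * hcosh \<kappa> v y"
  unfolding \<delta>_def hyp_exp_scaleR[OF assms(1-3)]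
  by (simp add: hcosh.add_left hcosh.scaleR_left)

text \<open>The quadric has two sheets. If \<open>x\<close> were on the lower one,
  \<open>- x\<close> would be on the upper one and \<open>hcosh_pos\<close> would give the wrong
  sign.\<close>

lemma mem_hyp_space_if_hcosh_pos:
  assumes "\<kappa> > 0" "p \<in> hyp_space \<kappa>" "hcosh \<kappa> x x = 1" "hcosh \<kappa> p x > 0"
  shows "x \<in> hyp_space \<kappa>"
proof -
  have "snd x \<noteq> 0" using snd_nonzero_if_hcosh_pos[OF assms(1), of x] assms(3) by simp
  moreover have "\<not> snd x < 0"
  proof
    assume "snd x < 0"
    then have "- x \<in> hyp_space \<kappa>"
      using assms(1,3) by (simp add: mem_hyp_space_iff hcosh.minus_left hcosh.minus_right)
    then have "hcosh \<kappa> p (- x) > 0" by (rule hcosh_pos[OF assms(1,2)])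
    with assms(4) show False by (simp add: hcosh.minus_right)
  qed
  ultimately show ?thesis using assms by (simp add: mem_hyp_space_iff)
qed

lemma hyp_exp_in_hyp_space:
  assumes "\<kappa> > 0" "p \<in> hyp_space \<kappa>" "v \<in> tangent_space p"
  shows "hyp_exp \<kappa> p v \<in> hyp_space \<kappa>"
proof (rule mem_hyp_space_if_hcosh_pos[OF assms(1,2)])
  define \<delta> where "\<delta> = sqrt \<kappa> * lorentz_norm v"
  have e: "hyp_exp \<kappa> p v = cosh \<delta> *\<^sub>R p + sinhc \<delta> *\<^sub>R v"
    unfolding \<delta>_def by (rule hyp_exp_eq) fact+
  have o: "hcosh \<kappa> p p = 1" "hcosh \<kappa> p v = 0" "hcosh \<kappa> v p = 0" "hcosh \<kappa> v v = - \<delta>\<^sup>2"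
    using assms lorentz_norm_square[OF assms] hcosh_commute[of \<kappa> v p]
    by (auto simp: mem_hyp_space_iff mem_tangent_space_iff \<delta>_def)
  have "hcosh \<kappa> (hyp_exp \<kappa> p v) (hyp_exp \<kappa> p v) = (cosh \<delta>)\<^sup>2 - (\<delta> * sinhc \<delta>)\<^sup>2"
    by (simp add: e o hcosh.add_left hcosh.add_right hcosh.scaleR_left hcosh.scaleR_right power2_eq_square)
  then show "hcosh \<kappa> (hyp_exp \<kappa> p v) (hyp_exp \<kappa> p v) = 1"
    by (simp add: mult_sinhc cosh_square_eq)
  show "hcosh \<kappa> p (hyp_exp \<kappa> p v) > 0"
    by (simp add: e o hcosh.add_right hcosh.scaleR_right)
qed

text \<open>The tangential part of \<open>q\<close> has scaled length sinh of the scaled distance,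
  so the normalizing quotient becomes \<open>1 / sinhc\<close>; at \<open>p = q\<close> both sides
  vanish.\<close>

lemma hyp_log_eq:
  assumes "\<kappa> > 0" "p \<in> hyp_space \<kappa>" "q \<in> hyp_space \<kappa>"
  shows "hyp_log \<kappa> p q = (1 / sinhc (arcosh (hcosh \<kappa> p q))) *\<^sub>R (q - hcosh \<kappa> p q *\<^sub>R p)"
proof (cases "p = q")
  case True
  then show ?thesis using hcosh_eq_1_iff[OF assms] by (simp add: hyp_log_def)
next
  case False
  define s where "s = hcosh \<kappa> p q"
  have s: "s > 1" using hcosh_eq_1_iff[OF assms] hcosh_ge_1[OF assms] False by (simp add: s_def)
  have w: "q + (\<kappa> * lorentz p q) *\<^sub>R p = q - s *\<^sub>R p" by (simp add: s_def hcosh_def)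
  have "sqrt (s\<^sup>2 - 1) = sqrt \<kappa> * lorentz_norm (q - s *\<^sub>R p)"
    unfolding lorentz_norm_def s_def hcosh_orthogonal_part(2)[OF assms, symmetric]
    by (simp add: real_sqrt_mult)
  moreover have "sqrt (s\<^sup>2 - 1) > 0" using s by simp
  ultimately have "hyp_dist \<kappa> p q / lorentz_norm (q - s *\<^sub>R p) = 1 / sinhc (arcosh s)"
    using assms(1) s by (simp add: hyp_dist_eq sinhc_arcosh flip: s_def)
  then show ?thesis using False by (simp add: hyp_log_def w flip: s_def)
qed

lemma hyp_log_in_tangent_space:
  assumes "\<kappa> > 0" "p \<in> hyp_space \<kappa>" "q \<in> hyp_space \<kappa>"
  shows "hyp_log \<kappa> p q \<in> tangent_space p"
  unfolding hyp_log_eq[OF assms] by (intro tangent_space_scaleR hcosh_orthogonal_part assms)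

lemma lorentz_norm_hyp_log:
  assumes "\<kappa> > 0" "p \<in> hyp_space \<kappa>" "q \<in> hyp_space \<kappa>"
  shows "sqrt \<kappa> * lorentz_norm (hyp_log \<kappa> p q) = arcosh (hcosh \<kappa> p q)"
proof -
  define s where "s = hcosh \<kappa> p q"
  define w where "w = q - s *\<^sub>R p"
  have s: "s \<ge> 1" using hcosh_ge_1[OF assms] by (simp add: s_def)
  have "sqrt \<kappa> * lorentz_norm (hyp_log \<kappa> p q) = (1 / sinhc (arcosh s)) * (sqrt \<kappa> * lorentz_norm w)"
    unfolding hyp_log_eq[OF assms] s_def[symmetric] w_def[symmetric] lorentz_norm_scaleR
    using less_imp_le[OF sinhc_pos] by simp
  also have "sqrt \<kappa> * lorentz_norm w = sqrt (\<kappa> * lorentz w w)"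
    by (simp add: lorentz_norm_def real_sqrt_mult)
  also have "\<kappa> * lorentz w w = s\<^sup>2 - 1"
    using hcosh_orthogonal_part(2)[OF assms] by (simp add: w_def s_def)
  also have "sqrt (s\<^sup>2 - 1) = arcosh s * sinhc (arcosh s)"
    using s by (simp add: mult_sinhc sinh_arcosh_real)
  finally show ?thesis using sinhc_pos[of "arcosh s"] by (simp add: s_def)
qed

lemma hyp_exp_hyp_log:
  assumes "\<kappa> > 0" "p \<in> hyp_space \<kappa>" "q \<in> hyp_space \<kappa>"
  shows "hyp_exp \<kappa> p (hyp_log \<kappa> p q) = q"
proof -
  define s where "s = hcosh \<kappa> p q"
  have s: "s \<ge> 1" using hcosh_ge_1[OF assms] by (simp add: s_def)
  have "hyp_exp \<kappa> p (hyp_log \<kappa> p q) = s *\<^sub>R p + sinhc (arcosh s) *\<^sub>R hyp_log \<kappa> p q"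
    using hyp_exp_eq[OF assms(1,2) hyp_log_in_tangent_space[OF assms]] s
    by (simp add: lorentz_norm_hyp_log[OF assms] flip: s_def)
  also have "\<dots> = q"
    using sinhc_pos[of "arcosh s"] by (simp add: hyp_log_eq[OF assms] flip: s_def)
  finally show ?thesis .
qed

text \<open>The hyperbolic law of cosines in linear form: \<open>c\<close> is the exponential of its
  logarithm, paired with an arbitrary ambient vector \<open>y\<close>.\<close>

lemma hcosh_via_hyp_log:
  assumes "\<kappa> > 0" "p \<in> hyp_space \<kappa>" "c \<in> hyp_space \<kappa>"
  shows "hcosh \<kappa> c y = hcosh \<kappa> p c * hcosh \<kappa> p y
    + sinhc (arcosh (hcosh \<kappa> p c)) * hcosh \<kappa> (hyp_log \<kappa> p c) y"
  using hcosh_hyp_exp_scaleR[OF assms(1,2) hyp_log_in_tangent_space[OF assms], of 1 y]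
    hcosh_ge_1[OF assms]
  by (simp add: hyp_exp_hyp_log[OF assms] lorentz_norm_hyp_log[OF assms])

text \<open>\<open>hcosh \<kappa> (hyp_log \<kappa> p c) q\<close> is the initial rate of change of
  \<open>hcosh\<close> to \<open>q\<close> along the geodesic from \<open>p\<close> to
  \<open>c\<close>. In the triangle \<open>p\<close>, \<open>c\<close>, \<open>q\<close> it equals
  \<open>- (D * sinh d * w)\<close>, which reduces the claim to the scalar inequality.\<close>

lemma arcosh_powr_hcosh_above_tangent:
  assumes "\<kappa> > 0" "p \<in> hyp_space \<kappa>" "c \<in> hyp_space \<kappa>" "q \<in> hyp_space \<kappa>" "p \<noteq> c" "\<sigma> \<ge> 2"
  shows "arcosh (hcosh \<kappa> p q) powr \<sigma>
      + arcosh_powr_deriv \<sigma> (hcosh \<kappa> p q) * hcosh \<kappa> (hyp_log \<kappa> p c) q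
    < arcosh (hcosh \<kappa> c q) powr \<sigma>"
proof -
  define v where "v = hyp_log \<kappa> p c"
  define u where "u = q - hcosh \<kappa> p q *\<^sub>R p"
  define b where "b = hcosh \<kappa> v q"
  define d where "d = arcosh (hcosh \<kappa> p q)"
  define D where "D = arcosh (hcosh \<kappa> p c)"
  note ge1 = hcosh_ge_1[OF assms(1,2,4)] hcosh_ge_1[OF assms(1,2,3)]
  have d: "d \<ge> 0" "cosh d = hcosh \<kappa> p q" "(sinh d)\<^sup>2 = (hcosh \<kappa> p q)\<^sup>2 - 1"
    using ge1 by (auto simp: d_def sinh_square_eq)
  have D: "D > 0" "cosh D = hcosh \<kappa> p c"
    using ge1 hcosh_eq_1_iff[OF assms(1-3)] assms(5) by (auto simp: D_def)
  have v: "v \<in> tangent_space p" unfolding v_def by (intro hyp_log_in_tangent_space assms)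
  have u: "u \<in> tangent_space p" "\<kappa> * lorentz u u = (sinh d)\<^sup>2"
    using hcosh_orthogonal_part[OF assms(1,2,4)] d by (auto simp: u_def)
  have vv: "\<kappa> * lorentz v v = D\<^sup>2"
    using lorentz_norm_square[OF assms(1,2) v] lorentz_norm_hyp_log[OF assms(1-3)]
    by (simp add: v_def D_def hcosh_def)
  have "b = hcosh \<kappa> v u"
    using v assms(1) hcosh_commute[of \<kappa> v p]
    by (simp add: b_def u_def hcosh.diff_right hcosh.scaleR_right mem_tangent_space_iff)
  then have "b\<^sup>2 = \<kappa>\<^sup>2 * (lorentz v u)\<^sup>2" by (simp add: hcosh_def power_mult_distrib)
  also have "\<dots> \<le> \<kappa>\<^sup>2 * (lorentz v v * lorentz u u)"
    using lorentz_tangent_Cauchy_Schwarz[OF assms(1,2) v u(1)] by (intro mult_left_mono) auto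
  also have "\<dots> = (\<kappa> * lorentz v v) * (\<kappa> * lorentz u u)" by (simp add: power2_eq_square)
  also have "\<dots> = (D * sinh d)\<^sup>2" by (simp add: vv u power_mult_distrib)
  finally have b: "\<bar>b\<bar> \<le> D * sinh d"
    using D d power2_le_iff_abs_le[of "D * sinh d" b] by simp
  \<comment> \<open>The cosine of the angle at \<open>p\<close>, within bounds by Cauchy-Schwarz. If
    \<open>q = p\<close> there is no angle and 0 is taken.\<close>
  obtain w where w: "\<bar>w\<bar> \<le> 1" "D * sinh d * w = - b"
  proof (cases "D * sinh d = 0")
    case True
    then have "b = 0" using b by linarith
    then show ?thesis using that[of 0] by simp
  next
    case False
    then have "D * sinh d > 0" using b by linarith
    then have "\<bar>- b / (D * sinh d)\<bar> \<le> 1" "D * sinh d * (- b / (D * sinh d)) = - b"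
      using b False by (auto simp: abs_divide)
    then show ?thesis using that by blast
  qed
  have "sinh d * sinh D * w = sinhc D * (D * sinh d * w)" by (simp flip: mult_sinhc[of D])
  then have "cosh d * cosh D - sinh d * sinh D * w = hcosh \<kappa> c q"
    using hcosh_via_hyp_log[OF assms(1-3), of q] d D w
    by (simp flip: b_def v_def D_def)
  then show ?thesis
    using arcosh_powr_above_tangent[OF assms(6) d(1) D(1) w(1)] w(2) d(2)
    by (simp add: b_def v_def flip: d_def)
qed

section \<open>Limits of exponentials and logarithms\<close>

lemma tendsto_hyp_exp_difference_quotient:
  fixes P V :: "nat \<Rightarrow> (real ^ 'n) \<times> real"
  assumes "\<kappa> > 0" and P: "\<And>k. P k \<in> hyp_space \<kappa>" and V: "\<And>k. V k \<in> tangent_space (P k)"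
    and lims: "P \<longlonglongrightarrow> p" "V \<longlonglongrightarrow> v" "\<tau> \<longlonglongrightarrow> 0" and nz: "\<And>k. \<tau> k \<noteq> 0"
  shows "(\<lambda>k. (hyp_exp \<kappa> (P k) (\<tau> k *\<^sub>R V k) - P k) /\<^sub>R \<tau> k) \<longlonglongrightarrow> v"
proof -
  define \<delta> where "\<delta> k = sqrt \<kappa> * lorentz_norm (V k)" for k
  have \<delta>: "\<delta> \<longlonglongrightarrow> sqrt \<kappa> * lorentz_norm v"
    unfolding \<delta>_def lorentz_norm_def by (intro tendsto_intros lorentz.tendsto lims)
  \<comment> \<open>The half-angle formula exhibits the quadratic smallness of cosh x - 1: after
    division by \<open>\<tau> k\<close> a factor \<open>\<tau> k\<close> remains and removes the
    component along \<open>P k\<close>.\<close>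
  have c: "cosh x - 1 = x\<^sup>2 / 2 * (sinhc (x / 2))\<^sup>2" for x :: real
  proof -
    have "cosh (2 * (x / 2)) = 2 * (sinh (x / 2))\<^sup>2 + 1"
      by (subst cosh_double) (simp add: cosh_square_eq)
    also have "sinh (x / 2) = x / 2 * sinhc (x / 2)" by (simp add: mult_sinhc)
    finally show ?thesis by (simp add: power_mult_distrib power_divide)
  qed
  have "(hyp_exp \<kappa> (P k) (\<tau> k *\<^sub>R V k) - P k) /\<^sub>R \<tau> k =
     (\<tau> k * ((\<delta> k)\<^sup>2 / 2 * (sinhc (\<tau> k * \<delta> k / 2))\<^sup>2)) *\<^sub>R P k + sinhc (\<tau> k * \<delta> k) *\<^sub>R V k" for k
  proof -
    have "hyp_exp \<kappa> (P k) (\<tau> k *\<^sub>R V k) - P k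
      = (cosh (\<tau> k * \<delta> k) - 1) *\<^sub>R P k + (\<tau> k * sinhc (\<tau> k * \<delta> k)) *\<^sub>R V k"
      unfolding \<delta>_def hyp_exp_scaleR[OF assms(1) P V] by (simp add: scaleR_diff_left)
    then show ?thesis
      using nz[of k] by (simp add: c scaleR_add_right power2_eq_square mult.assoc[symmetric])
  qed
  moreover have "(\<lambda>k. (\<tau> k * ((\<delta> k)\<^sup>2 / 2 * (sinhc (\<tau> k * \<delta> k / 2))\<^sup>2)) *\<^sub>R P k + sinhc (\<tau> k * \<delta> k) *\<^sub>R V k)
     \<longlonglongrightarrow> (0 * ((sqrt \<kappa> * lorentz_norm v)\<^sup>2 / 2 * (sinhc (0 * (sqrt \<kappa> * lorentz_norm v) / 2))\<^sup>2)) *\<^sub>R p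
       + sinhc (0 * (sqrt \<kappa> * lorentz_norm v)) *\<^sub>R v"
    by (intro tendsto_intros lims \<delta>) auto
  ultimately show ?thesis by (simp add: sinhc_def)
qed

lemma tendsto_hyp_exp:
  fixes P V :: "nat \<Rightarrow> (real ^ 'n) \<times> real"
  assumes "\<kappa> > 0" and P: "\<And>k. P k \<in> hyp_space \<kappa>" and V: "\<And>k. V k \<in> tangent_space (P k)"
    and p: "p \<in> hyp_space \<kappa>" and v: "v \<in> tangent_space p"
    and lims: "P \<longlonglongrightarrow> p" "V \<longlonglongrightarrow> v"
  shows "(\<lambda>k. hyp_exp \<kappa> (P k) (V k)) \<longlonglongrightarrow> hyp_exp \<kappa> p v"
  unfolding hyp_exp_eq[OF assms(1) P V] hyp_exp_eq[OF assms(1) p v] lorentz_norm_def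
  by (intro tendsto_intros lims lorentz.tendsto)

lemma tendsto_hyp_log:
  assumes "\<kappa> > 0" and P: "\<And>k. P k \<in> hyp_space \<kappa>" and Q: "\<And>k. Q k \<in> hyp_space \<kappa>"
    and p: "p \<in> hyp_space \<kappa>" and q: "q \<in> hyp_space \<kappa>"
    and lims: "P \<longlonglongrightarrow> p" "Q \<longlonglongrightarrow> q"
  shows "(\<lambda>k. hyp_log \<kappa> (P k) (Q k)) \<longlonglongrightarrow> hyp_log \<kappa> p q"
  unfolding hyp_log_eq[OF assms(1) P Q] hyp_log_eq[OF assms(1) p q]
  by (intro tendsto_intros lims hcosh.tendsto)
     (auto simp: hcosh_ge_1 assms less_imp_neq[OF sinhc_pos, symmetric])

subsection \<open>Projections onto convex sets\<close>

text \<open>The equation of the hyperboloid reads 1 = \<kappa> (a - b)(a + b). Multiplying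
  \<open>snd q\<close> by it makes the left side of \<open>snd_le_hcosh\<close> appear, and a + b is
  at most 2a.\<close>

lemma snd_le_snd_mult_hcosh:
  assumes "\<kappa> > 0" "p \<in> hyp_space \<kappa>" "q \<in> hyp_space \<kappa>"
  shows "snd q \<le> 2 * snd p * hcosh \<kappa> p q"
proof -
  define a b where "a = snd p" and "b = norm (fst p)"
  have ab: "b < a" "0 \<le> b" using hyp_space_norm_fst_less[OF assms(1,2)] by (auto simp: a_def b_def)
  have 1: "\<kappa> * ((a - b) * (a + b)) = 1"
    using assms(1,2) unfolding a_def b_def
    by (simp add: mem_hyp_space_iff hcosh_def lorentz_eq_inner power2_norm_eq_inner[symmetric]
        power2_eq_square algebra_simps)
  have "snd q > 0" using assms(3) by (simp add: hyp_space_def)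
  have "snd q = snd q * (\<kappa> * ((a - b) * (a + b)))" by (simp only: 1)
  also have "\<dots> = (\<kappa> * snd q * (a - b)) * (a + b)" by simp
  also have "\<dots> \<le> hcosh \<kappa> q p * (a + b)"
    using snd_le_hcosh[OF assms(1,3), of p, folded a_def b_def] ab by (intro mult_right_mono) auto
  also have "\<dots> \<le> hcosh \<kappa> q p * (2 * a)"
    using ab hcosh_pos[OF assms(1,3,2)] by (intro mult_left_mono) auto
  finally show ?thesis by (simp add: a_def hcosh_commute mult.commute)
qed

lemma norm_le_snd:
  assumes "\<kappa> > 0" "p \<in> hyp_space \<kappa>" shows "norm p \<le> 2 * snd p"
  using norm_Pair_le[of "fst p" "snd p"] hyp_space_norm_fst_less[OF assms] assms(2)
  by (auto simp: hyp_space_def)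

lemma norm_le_hcosh:
  assumes "\<kappa> > 0" "p \<in> hyp_space \<kappa>" "q \<in> hyp_space \<kappa>"
  shows "norm q \<le> 4 * norm p * hcosh \<kappa> p q"
proof -
  have "norm q \<le> 4 * snd p * hcosh \<kappa> p q"
    using norm_le_snd[OF assms(1,3)] snd_le_snd_mult_hcosh[OF assms] by simp
  also have "snd p \<le> norm p" using norm_snd_le[of "snd p" "fst p"] by simp
  finally show ?thesis using hcosh_pos[OF assms] by (simp add: mult_right_mono)
qed

section \<open>Existence, uniqueness and angle property of the projection\<close>

lemma hyp_convexD:
  assumes "\<kappa> > 0" "hyp_convex \<kappa> C" "p \<in> C" "c \<in> C" "0 \<le> t" "t \<le> 1"
  shows "hyp_exp \<kappa> p (t *\<^sub>R hyp_log \<kappa> p c) \<in> C"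
  using assms by (auto simp: hyp_convex_def geodesic_segment_def image_subset_iff)

text \<open>Because arcosh is strictly increasing on \<open>{1..}\<close>, minimizing
  \<open>hcosh\<close> amounts to minimizing the distance, with a linear function in place of the
  distance.\<close>

definition is_hyp_closest :: "real \<Rightarrow> ((real ^ 'n) \<times> real) set \<Rightarrow> (real ^ 'n) \<times> real \<Rightarrow> (real ^ 'n) \<times> real \<Rightarrow> bool" where
  "is_hyp_closest \<kappa> C y z \<longleftrightarrow> z \<in> C \<and> (\<forall>c\<in>C. hcosh \<kappa> y z \<le> hcosh \<kappa> y c)"

lemma is_hyp_closest_iff:
  assumes "\<kappa> > 0" "C \<subseteq> hyp_space \<kappa>" "y \<in> hyp_space \<kappa>"
  shows "is_arg_min (hyp_dist \<kappa> y) (\<lambda>q. q \<in> C) z \<longleftrightarrow> is_hyp_closest \<kappa> C y z"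
proof -
  have "hyp_dist \<kappa> y c < hyp_dist \<kappa> y z \<longleftrightarrow> hcosh \<kappa> y c < hcosh \<kappa> y z" if "c \<in> C" "z \<in> C" for c
    using that assms(2) by (intro hyp_dist_less_iff hcosh_ge_1 assms) auto
  then show ?thesis unfolding is_arg_min_def is_hyp_closest_def by (meson not_le)
qed

text \<open>The points of \<open>C\<close> no farther from \<open>y\<close> than some
  \<open>c0\<close> form a compact set by \<open>norm_le_hcosh\<close>, and the minimum there is
  global.\<close>

lemma hyp_closest_exists:
  fixes C :: "((real ^ 'n) \<times> real) set"
  assumes "\<kappa> > 0" "C \<subseteq> hyp_space \<kappa>" "y \<in> hyp_space \<kappa>" "closed C" "C \<noteq> {}"
  shows "\<exists>z. is_hyp_closest \<kappa> C y z"
proof -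
  obtain c0 where c0: "c0 \<in> C" using assms by blast
  define K where "K = C \<inter> {x. hcosh \<kappa> y x \<le> hcosh \<kappa> y c0}"
  have "closed K" unfolding K_def
    by (intro closed_Int closed_Collect_le continuous_intros hcosh.continuous_on assms)
  moreover have "bounded K"
  proof (rule boundedI)
    fix x assume x: "x \<in> K"
    have "norm x \<le> 4 * norm y * hcosh \<kappa> y x" using x assms by (intro norm_le_hcosh) (auto simp: K_def)
    also have "\<dots> \<le> 4 * norm y * hcosh \<kappa> y c0" using x by (intro mult_left_mono) (auto simp: K_def)
    finally show "norm x \<le> 4 * norm y * hcosh \<kappa> y c0" .
  qed
  ultimately have "compact K" by (simp add: compact_eq_bounded_closed)
  moreover have "K \<noteq> {}" using c0 by (auto simp: K_def)
  moreover have "continuous_on K (hcosh \<kappa> y)" by (intro hcosh.continuous_on continuous_intros)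
  ultimately obtain z where z: "z \<in> K" "\<forall>x\<in>K. hcosh \<kappa> y z \<le> hcosh \<kappa> y x"
    using continuous_attains_inf by blast
  have "hcosh \<kappa> y z \<le> hcosh \<kappa> y c" if "c \<in> C" for c
    using z that by (cases "hcosh \<kappa> y c \<le> hcosh \<kappa> y c0") (auto simp: K_def)
  then show ?thesis using z(1) unfolding is_hyp_closest_def K_def by blast
qed

text \<open>The geodesic from \<open>z\<close> to \<open>c\<close> stays in \<open>C\<close>, so the
  difference quotients of \<open>hcosh\<close> to \<open>y\<close> along it are nonnegative at the
  steps 1/(k+1); their limit is the claim.\<close>

lemma hyp_closest_first_order:
  fixes C :: "((real ^ 'n) \<times> real) set"
  assumes "\<kappa> > 0" "C \<subseteq> hyp_space \<kappa>" "hyp_convex \<kappa> C" "is_hyp_closest \<kappa> C y z" "c \<in> C"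
  shows "hcosh \<kappa> (hyp_log \<kappa> z c) y \<ge> 0"
proof -
  define v where "v = hyp_log \<kappa> z c"
  have z: "z \<in> C" "z \<in> hyp_space \<kappa>" "c \<in> hyp_space \<kappa>"
    using assms by (auto simp: is_hyp_closest_def)
  have v: "v \<in> tangent_space z" unfolding v_def by (intro hyp_log_in_tangent_space assms z)
  define \<tau> where "\<tau> k = 1 / real (Suc k)" for k
  have "(\<lambda>k. (hyp_exp \<kappa> z (\<tau> k *\<^sub>R v) - z) /\<^sub>R \<tau> k) \<longlonglongrightarrow> v"
    by (rule tendsto_hyp_exp_difference_quotient[OF assms(1) z(2) v])
       (use LIMSEQ_inverse_real_of_nat in \<open>auto simp: \<tau>_def inverse_eq_divide\<close>)
  then have "(\<lambda>k. hcosh \<kappa> ((hyp_exp \<kappa> z (\<tau> k *\<^sub>R v) - z) /\<^sub>R \<tau> k) y) \<longlonglongrightarrow> hcosh \<kappa> v y"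
    by (intro hcosh.tendsto tendsto_const)
  moreover have "0 \<le> hcosh \<kappa> ((hyp_exp \<kappa> z (\<tau> k *\<^sub>R v) - z) /\<^sub>R \<tau> k) y" for k
  proof -
    have "hyp_exp \<kappa> z (\<tau> k *\<^sub>R v) \<in> C" unfolding v_def
      by (rule hyp_convexD) (use assms z in \<open>auto simp: \<tau>_def\<close>)
    then have "hcosh \<kappa> y z \<le> hcosh \<kappa> y (hyp_exp \<kappa> z (\<tau> k *\<^sub>R v))"
      using assms(4) by (auto simp: is_hyp_closest_def)
    then show ?thesis
      by (simp add: hcosh.scaleR_left hcosh.diff_left hcosh_commute[of \<kappa> _ y] \<tau>_def)
  qed
  ultimately show ?thesis unfolding v_def by (intro LIMSEQ_le_const) auto
qed

text \<open>Hyperbolic Pythagoras at the projection \<open>z\<close>, where the angle is obtuse.\<close>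

lemma hyp_closest_obtuse:
  assumes "\<kappa> > 0" "C \<subseteq> hyp_space \<kappa>" "hyp_convex \<kappa> C" "is_hyp_closest \<kappa> C y z" "c \<in> C"
  shows "hcosh \<kappa> z c * hcosh \<kappa> z y \<le> hcosh \<kappa> c y"
proof -
  have "z \<in> hyp_space \<kappa>" "c \<in> hyp_space \<kappa>"
    using assms by (auto simp: is_hyp_closest_def)
  from hcosh_via_hyp_log[OF assms(1) this, of y] show ?thesis
    using hyp_closest_first_order[OF assms] less_imp_le[OF sinhc_pos] by (simp add: mult_nonneg_nonneg)
qed

text \<open>The obtuse-angle inequality between two closest points forces
  \<open>hcosh \<kappa> z c \<le> 1\<close>.\<close>

lemma hyp_closest_unique:
  assumes "\<kappa> > 0" "C \<subseteq> hyp_space \<kappa>" "hyp_convex \<kappa> C" "y \<in> hyp_space \<kappa>"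
    "is_hyp_closest \<kappa> C y z" "is_hyp_closest \<kappa> C y c"
  shows "c = z"
proof -
  have zc: "z \<in> C" "c \<in> C" "z \<in> hyp_space \<kappa>" "c \<in> hyp_space \<kappa>" "hcosh \<kappa> c y \<le> hcosh \<kappa> z y"
    using assms by (auto simp: is_hyp_closest_def hcosh_commute[of \<kappa> y])
  have "hcosh \<kappa> z c * hcosh \<kappa> z y \<le> 1 * hcosh \<kappa> z y"
    using hyp_closest_obtuse[OF assms(1-3,5) zc(2)] zc(5) by simp
  then have "hcosh \<kappa> z c \<le> 1"
    using hcosh_pos[OF assms(1) zc(3) assms(4)] by (simp add: mult_le_cancel_right_pos)
  then show ?thesis using hcosh_ge_1[OF assms(1) zc(3,4)] hcosh_eq_1_iff[OF assms(1) zc(3,4)] by simp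
qed

lemma is_hyp_closest_hyp_proj:
  fixes C :: "((real ^ 'n) \<times> real) set"
  assumes "\<kappa> > 0" "C \<subseteq> hyp_space \<kappa>" "hyp_convex \<kappa> C" "closed C" "C \<noteq> {}" "y \<in> hyp_space \<kappa>"
  shows "is_hyp_closest \<kappa> C y (hyp_proj \<kappa> C y)"
proof -
  obtain z where z: "is_hyp_closest \<kappa> C y z"
    using hyp_closest_exists[OF assms(1,2,6,4,5)] by blast
  then have "hyp_proj \<kappa> C y = z"
    unfolding hyp_proj_def is_hyp_closest_iff[OF assms(1,2,6)]
    by (rule the_equality) (rule hyp_closest_unique[OF assms(1-3,6) z])
  with z show ?thesis by simp
qed

text \<open>The exponential expands y as cosh \<delta> times \<open>p\<close> minus a positive
  multiple of \<open>g\<close>. For \<open>z \<noteq> p\<close> this is inserted in the obtuse-angle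
  inequality with \<open>p\<close> as competitor; for \<open>z = p\<close> in the first-order
  condition at \<open>p\<close>, where the \<open>p\<close> component is orthogonal to the
  logarithm.\<close>

lemma hyp_closest_descent:
  fixes C :: "((real ^ 'n) \<times> real) set"
  assumes "\<kappa> > 0" "C \<subseteq> hyp_space \<kappa>" "hyp_convex \<kappa> C" "p \<in> C" "g \<in> tangent_space p" "\<alpha> > 0"
    and z: "is_hyp_closest \<kappa> C (hyp_exp \<kappa> p (- \<alpha> *\<^sub>R g)) z"
  shows "z \<noteq> p \<Longrightarrow> lorentz g (hyp_log \<kappa> p z) < 0"
    and "z = p \<Longrightarrow> c \<in> C \<Longrightarrow> lorentz g (hyp_log \<kappa> p c) \<ge> 0"
proof -
  define y where "y = hyp_exp \<kappa> p (- \<alpha> *\<^sub>R g)"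
  define \<delta> where "\<delta> = - \<alpha> * (sqrt \<kappa> * lorentz_norm g)"
  have p: "p \<in> hyp_space \<kappa>" and zH: "z \<in> hyp_space \<kappa>" "z \<in> C"
    using assms by (auto simp: is_hyp_closest_def)
  have y: "hcosh \<kappa> y x = cosh \<delta> * hcosh \<kappa> p x - \<alpha> * sinhc \<delta> * hcosh \<kappa> g x" for x
    using hcosh_hyp_exp_scaleR[OF assms(1) p assms(5), of "- \<alpha>" x] by (simp add: y_def \<delta>_def)
  have pos: "\<alpha> * sinhc \<delta> > 0" using assms(6) sinhc_pos by simp
  have gp: "hcosh \<kappa> p p = 1" "hcosh \<kappa> g p = 0"
    using p assms(1,5) hcosh_commute[of \<kappa> g p] by (auto simp: mem_hyp_space_iff mem_tangent_space_iff)
  note z' = z[folded y_def]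
  {
    assume "z \<noteq> p"
    define s where "s = hcosh \<kappa> p z"
    have s: "s > 1" using hcosh_ge_1[OF assms(1) p zH(1)] hcosh_eq_1_iff[OF assms(1) p zH(1)] \<open>z \<noteq> p\<close>
      by (auto simp: s_def)
    have "hcosh \<kappa> z p * hcosh \<kappa> y z \<le> hcosh \<kappa> y p"
      using hyp_closest_obtuse[OF assms(1-3) z' assms(4)] by (simp add: hcosh_commute[of \<kappa> y])
    then have "s * (cosh \<delta> * s - \<alpha> * sinhc \<delta> * hcosh \<kappa> g z) \<le> cosh \<delta>"
      by (simp add: y gp s_def hcosh_commute[of \<kappa> z p])
    \<comment> \<open>Split off cosh \<delta> (s s - 1), which is positive as \<open>s > 1\<close>;
      the gradient term must outweigh it.\<close>
    moreover have "s * (cosh \<delta> * s - \<alpha> * sinhc \<delta> * hcosh \<kappa> g z)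
      = cosh \<delta> * (s * s - 1) + cosh \<delta> - s * (\<alpha> * sinhc \<delta>) * hcosh \<kappa> g z"
      by (simp add: algebra_simps)
    moreover have "cosh \<delta> * (s * s - 1) > 0"
      using s less_1_mult[of s s] by (intro mult_pos_pos) auto
    ultimately have "s * (\<alpha> * sinhc \<delta>) * hcosh \<kappa> g z > 0" by linarith
    moreover have "s * (\<alpha> * sinhc \<delta>) > 0" using s pos by simp
    ultimately have "hcosh \<kappa> g z > 0" by (rule zero_less_mult_pos)
    then have "lorentz g z < 0" using assms(1) by (simp add: hcosh_def mult_less_0_iff zero_less_mult_iff)
    moreover have "lorentz g p = 0" using assms(5) by (simp add: tangent_space_def lorentz_commute)
    ultimately show "lorentz g (hyp_log \<kappa> p z) < 0"
      unfolding hyp_log_eq[OF assms(1) p zH(1)] using sinhc_pos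
      by (simp add: lorentz.scaleR_right lorentz.diff_right divide_neg_pos)
  }
  {
    assume "z = p" and c: "c \<in> C"
    let ?v = "hyp_log \<kappa> p c"
    have "?v \<in> tangent_space p" using c assms(2) by (intro hyp_log_in_tangent_space assms p) auto
    then have "hcosh \<kappa> p ?v = 0" using assms(1) by (simp add: mem_tangent_space_iff)
    moreover have "0 \<le> hcosh \<kappa> y ?v"
      using hyp_closest_first_order[OF assms(1-3) z' c] \<open>z = p\<close> by (simp add: hcosh_commute)
    ultimately have "\<alpha> * sinhc \<delta> * hcosh \<kappa> g ?v \<le> 0" by (simp add: y)
    then have "hcosh \<kappa> g ?v \<le> 0" using pos by (meson mult_pos_pos not_le)
    then show "lorentz g ?v \<ge> 0" using assms(1) by (simp add: hcosh_def zero_le_mult_iff)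
  }
qed

subsection \<open>The center of mass function\<close>

locale hyp_center_of_mass =
  fixes \<kappa> \<sigma> :: real and m :: nat and \<mu> :: "nat \<Rightarrow> real" and q :: "nat \<Rightarrow> (real ^ 'n) \<times> real"
  assumes kappa: "\<kappa> > 0" and sigma: "\<sigma> \<ge> 2" and m: "m \<ge> 1"
    and q: "\<And>i. i \<in> {1..m} \<Longrightarrow> q i \<in> hyp_space \<kappa>"
    and \<mu>: "\<And>i. i \<in> {1..m} \<Longrightarrow> \<mu> i > 0"
begin

abbreviation f :: "(real ^ 'n) \<times> real \<Rightarrow> real" where
  "f \<equiv> center_of_mass_fun \<kappa> \<sigma> m \<mu> q"

text \<open>Absorbs the scaling 1 / sqrt \<kappa> of \<open>hyp_dist\<close>, so that each summand
  of the objective is a multiple of an arcosh power.\<close>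

definition w :: "nat \<Rightarrow> real" where
  "w i = \<mu> i * (1 / sqrt \<kappa>) powr \<sigma>"

definition f' :: "(real ^ 'n) \<times> real \<Rightarrow> (real ^ 'n) \<times> real \<Rightarrow> real" where
  "f' p v = (\<Sum>i=1..m. w i * (arcosh_powr_deriv \<sigma> (hcosh \<kappa> p (q i)) * hcosh \<kappa> v (q i)))"

text \<open>The Riesz representative of \<open>f'\<close> in the tangent space: each
  \<open>q i\<close> is replaced by its tangential part, and \<open>- \<kappa>\<close> converts
  \<open>hcosh\<close> to the Lorentz form.\<close>

definition grad :: "(real ^ 'n) \<times> real \<Rightarrow> (real ^ 'n) \<times> real" where
  "grad p = (\<Sum>i=1..m. (- \<kappa> * w i * arcosh_powr_deriv \<sigma> (hcosh \<kappa> p (q i)))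
                         *\<^sub>R (q i - hcosh \<kappa> p (q i) *\<^sub>R p))"

lemma w_pos: "i \<in> {1..m} \<Longrightarrow> w i > 0"
  using \<mu> kappa by (simp add: w_def)

lemma f_eq: "x \<in> hyp_space \<kappa> \<Longrightarrow> f x = (\<Sum>i=1..m. w i * arcosh (hcosh \<kappa> x (q i)) powr \<sigma>)"
  unfolding center_of_mass_fun_def w_def
  using hcosh_ge_1[OF kappa _ q] kappa
  by (intro sum.cong) (auto simp: hyp_dist_eq powr_divide)

lemma f_above_tangent:
  assumes "p \<in> hyp_space \<kappa>" "c \<in> hyp_space \<kappa>" "p \<noteq> c"
  shows "f p + f' p (hyp_log \<kappa> p c) < f c"
proof -
  have "f p + f' p (hyp_log \<kappa> p c) = (\<Sum>i=1..m. w i * (arcosh (hcosh \<kappa> p (q i)) powr \<sigma>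
      + arcosh_powr_deriv \<sigma> (hcosh \<kappa> p (q i)) * hcosh \<kappa> (hyp_log \<kappa> p c) (q i)))"
    by (simp add: f_eq assms f'_def sum.distrib distrib_left)
  also have "\<dots> < (\<Sum>i=1..m. w i * arcosh (hcosh \<kappa> c (q i)) powr \<sigma>)"
    using m by (intro sum_strict_mono mult_strict_left_mono arcosh_powr_hcosh_above_tangent
        w_pos kappa assms q sigma) auto
  also have "\<dots> = f c" by (simp add: f_eq assms)
  finally show ?thesis .
qed

section \<open>Differentiability and the Riemannian gradient\<close>

text \<open>\<open>hcosh\<close> is linear, so its quotients are \<open>hcosh\<close> of the vector
  quotients, and the arcosh version with moving base points applies. Constant \<open>P\<close>
  serves the line search, varying \<open>P\<close> the limit of rejected steps.\<close>

lemma tendsto_f_difference_quotient: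
  assumes P: "\<And>k. P k \<in> hyp_space \<kappa>" and V: "\<And>k. V k \<in> tangent_space (P k)"
    and lims: "P \<longlonglongrightarrow> p" "V \<longlonglongrightarrow> v" "\<tau> \<longlonglongrightarrow> 0" and nz: "\<And>k. \<tau> k \<noteq> 0"
  shows "(\<lambda>k. (f (hyp_exp \<kappa> (P k) (\<tau> k *\<^sub>R V k)) - f (P k)) / \<tau> k) \<longlonglongrightarrow> f' p v"
proof -
  define E where "E k = hyp_exp \<kappa> (P k) (\<tau> k *\<^sub>R V k)" for k
  have E: "E k \<in> hyp_space \<kappa>" for k unfolding E_def
    by (intro hyp_exp_in_hyp_space kappa P tangent_space_scaleR V)
  have quot: "(\<lambda>k. (E k - P k) /\<^sub>R \<tau> k) \<longlonglongrightarrow> v"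
    unfolding E_def by (rule tendsto_hyp_exp_difference_quotient) (use kappa assms in auto)
  have "(\<lambda>k. P k + \<tau> k *\<^sub>R ((E k - P k) /\<^sub>R \<tau> k)) \<longlonglongrightarrow> p + 0 *\<^sub>R v"
    by (intro tendsto_intros lims quot)
  then have Ep: "E \<longlonglongrightarrow> p" using nz by simp
  have "(\<lambda>k. (arcosh (hcosh \<kappa> (E k) (q i)) powr \<sigma> - arcosh (hcosh \<kappa> (P k) (q i)) powr \<sigma>) / \<tau> k)
      \<longlonglongrightarrow> arcosh_powr_deriv \<sigma> (hcosh \<kappa> p (q i)) * hcosh \<kappa> v (q i)" if i: "i \<in> {1..m}" for i
  proof (rule tendsto_arcosh_powr_difference_quotient[OF sigma])
    show "(\<lambda>k. hcosh \<kappa> (P k) (q i)) \<longlonglongrightarrow> hcosh \<kappa> p (q i)"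
      "(\<lambda>k. hcosh \<kappa> (E k) (q i)) \<longlonglongrightarrow> hcosh \<kappa> p (q i)"
      by (intro hcosh.tendsto lims Ep tendsto_const)+
    have "(\<lambda>k. hcosh \<kappa> ((E k - P k) /\<^sub>R \<tau> k) (q i)) \<longlonglongrightarrow> hcosh \<kappa> v (q i)"
      by (intro hcosh.tendsto quot tendsto_const)
    then show "(\<lambda>k. (hcosh \<kappa> (E k) (q i) - hcosh \<kappa> (P k) (q i)) / \<tau> k) \<longlonglongrightarrow> hcosh \<kappa> v (q i)"
      by (simp add: hcosh.scaleR_left hcosh.diff_left divide_inverse mult.commute)
  qed (use hcosh_ge_1[OF kappa P q[OF i]] hcosh_ge_1[OF kappa E q[OF i]] in auto)
  then have "(\<lambda>k. \<Sum>i=1..m. w i * ((arcosh (hcosh \<kappa> (E k) (q i)) powr \<sigma>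
      - arcosh (hcosh \<kappa> (P k) (q i)) powr \<sigma>) / \<tau> k)) \<longlonglongrightarrow> f' p v"
    unfolding f'_def by (intro tendsto_sum tendsto_mult tendsto_const)
  then show ?thesis
    by (simp add: f_eq P E sum_subtractf sum_divide_distrib diff_divide_distrib right_diff_distrib
        flip: E_def)
qed

text \<open>On the hyperboloid \<open>hcosh\<close> takes values in \<open>{1..}\<close>, so the
  derivative of the arcosh power within that half-line suffices, also at
  \<open>p = q i\<close>.\<close>

lemma f_has_derivative:
  assumes p: "p \<in> hyp_space \<kappa>"
  shows "(f has_derivative f' p) (at p within hyp_space \<kappa>)"
proof -
  have "((\<lambda>x. arcosh (hcosh \<kappa> x (q i)) powr \<sigma>) has_derivative
      (\<lambda>v. arcosh_powr_deriv \<sigma> (hcosh \<kappa> p (q i)) * hcosh \<kappa> v (q i))) (at p within hyp_space \<kappa>)"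
    if i: "i \<in> {1..m}" for i
  proof (rule has_derivative_in_compose[of "\<lambda>x. hcosh \<kappa> x (q i)" "\<lambda>x. hcosh \<kappa> x (q i)" p "hyp_space \<kappa>"])
    show "((\<lambda>x. hcosh \<kappa> x (q i)) has_derivative (\<lambda>x. hcosh \<kappa> x (q i))) (at p within hyp_space \<kappa>)"
      using bounded_linear_imp_has_derivative[OF hcosh.bounded_linear_left] .
    have "((\<lambda>s. arcosh s powr \<sigma>) has_derivative (\<lambda>y. arcosh_powr_deriv \<sigma> (hcosh \<kappa> p (q i)) * y))
        (at (hcosh \<kappa> p (q i)) within {1..})"
      using arcosh_powr_has_derivative_within[OF sigma hcosh_ge_1[OF kappa p q[OF i]]]
      by (simp add: has_field_derivative_def)
    then show "((\<lambda>s. arcosh s powr \<sigma>) has_derivative (\<lambda>y. arcosh_powr_deriv \<sigma> (hcosh \<kappa> p (q i)) * y))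
        (at (hcosh \<kappa> p (q i)) within (\<lambda>x. hcosh \<kappa> x (q i)) ` hyp_space \<kappa>)"
      by (rule has_derivative_subset) (use hcosh_ge_1[OF kappa _ q[OF i]] in auto)
  qed
  then have "((\<lambda>x. \<Sum>i=1..m. w i * arcosh (hcosh \<kappa> x (q i)) powr \<sigma>) has_derivative f' p)
      (at p within hyp_space \<kappa>)"
    unfolding f'_def by (intro has_derivative_sum has_derivative_mult_right)
  then show ?thesis
    by (rule has_derivative_transform[rotated 2]) (use p f_eq in auto)
qed

lemma grad_in_tangent_space:
  assumes "p \<in> hyp_space \<kappa>" shows "grad p \<in> tangent_space p"
proof -
  have "lorentz p (q i - hcosh \<kappa> p (q i) *\<^sub>R p) = 0" if "i \<in> {1..m}" for i
    using hcosh_orthogonal_part(1)[OF kappa assms q[OF that]] by (simp add: tangent_space_def)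
  then show ?thesis by (simp add: grad_def tangent_space_def lorentz.sum_right lorentz.scaleR_right
      lorentz.minus_right)
qed

lemma lorentz_grad:
  assumes "v \<in> tangent_space p" shows "lorentz (grad p) v = f' p v"
  using assms unfolding grad_def f'_def lorentz.sum_left
  by (intro sum.cong) (simp_all add: lorentz.scaleR_left lorentz.minus_left lorentz.diff_left
      tangent_space_def hcosh_commute[of \<kappa> v] hcosh_def[of \<kappa> _ v])

lemma hyp_exp_has_vector_derivative:
  assumes "p \<in> hyp_space \<kappa>" "v \<in> tangent_space p"
  shows "((\<lambda>t. hyp_exp \<kappa> p (t *\<^sub>R v)) has_vector_derivative v) (at 0)"
proof -
  define \<delta> where "\<delta> = sqrt \<kappa> * lorentz_norm v"
  have *: "hyp_exp \<kappa> p (t *\<^sub>R v)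
    = cosh (t * \<delta>) *\<^sub>R p + (if \<delta> = 0 then t else sinh (t * \<delta>) / \<delta>) *\<^sub>R v" for t
    unfolding hyp_exp_scaleR[OF kappa assms] \<delta>_def[symmetric] by (simp add: sinhc_def)
  show ?thesis unfolding *
    by (cases "\<delta> = 0") (auto intro!: derivative_eq_intros simp: has_vector_derivative_def)
qed

text \<open>An ambient derivative is not unique off the tangent space. The chain rule along the
  geodesics t to exp(t v) fixes it on tangent vectors, and definiteness of the form there identifies
  the gradient.\<close>

lemma hyp_grad_eq:
  assumes p: "p \<in> hyp_space \<kappa>"
  shows "hyp_grad \<kappa> f p = grad p"
  unfolding hyp_grad_def
proof (rule the_equality)
  show "has_hyp_grad \<kappa> f p (grad p)"
    unfolding has_hyp_grad_def
    using grad_in_tangent_space[OF p] f_has_derivative[OF p] lorentz_grad by metis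
  fix g assume "has_hyp_grad \<kappa> f p g"
  then obtain D where g: "g \<in> tangent_space p" and D: "(f has_derivative D) (at p within hyp_space \<kappa>)"
    and Dg: "\<And>v. v \<in> tangent_space p \<Longrightarrow> D v = lorentz g v"
    unfolding has_hyp_grad_def by blast
  have eq: "lorentz g v = lorentz (grad p) v" if v: "v \<in> tangent_space p" for v
  proof -
    let ?c = "\<lambda>t. hyp_exp \<kappa> p (t *\<^sub>R v)"
    have c0: "?c 0 = p" by (simp add: hyp_exp_def)
    have chain: "((\<lambda>t. f (?c t)) has_derivative (\<lambda>t. F (t *\<^sub>R v))) (at 0)"
      if F: "(f has_derivative F) (at p within hyp_space \<kappa>)" for F
    proof (rule has_derivative_in_compose[where f = "?c" and g = f and g' = F and s = UNIV])
      show "(?c has_derivative (\<lambda>t. t *\<^sub>R v)) (at 0)"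
        using hyp_exp_has_vector_derivative[OF p v] by (simp add: has_vector_derivative_def)
      show "(f has_derivative F) (at (?c 0) within range ?c)"
        unfolding c0 by (rule has_derivative_subset[OF F])
          (auto intro!: hyp_exp_in_hyp_space kappa p tangent_space_scaleR v)
    qed
    have "(\<lambda>t. D (t *\<^sub>R v)) = (\<lambda>t. f' p (t *\<^sub>R v))"
      by (rule has_derivative_unique[OF chain[OF D] chain[OF f_has_derivative[OF p]]])
    then have "D (1 *\<^sub>R v) = f' p (1 *\<^sub>R v)" by meson
    then show ?thesis using Dg[OF v] lorentz_grad[OF v] by simp
  qed
  have t: "g - grad p \<in> tangent_space p"
    using g grad_in_tangent_space[OF p] by (simp add: tangent_space_def lorentz.diff_right)
  have "lorentz (g - grad p) (g - grad p) = 0"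
    using eq[OF t] by (simp add: lorentz.diff_left)
  then show "g = grad p" using lorentz_tangent_eq_0[OF kappa p t] by simp
qed

lemma tendsto_grad:
  assumes "\<And>k. P k \<in> hyp_space \<kappa>" "p \<in> hyp_space \<kappa>" "P \<longlonglongrightarrow> p"
  shows "(\<lambda>k. grad (P k)) \<longlonglongrightarrow> grad p"
proof -
  have "(\<lambda>k. arcosh_powr_deriv \<sigma> (hcosh \<kappa> (P k) (q i))) \<longlonglongrightarrow> arcosh_powr_deriv \<sigma> (hcosh \<kappa> p (q i))"
    if "i \<in> {1..m}" for i
    by (intro continuous_on_tendsto_compose[OF continuous_on_arcosh_powr_deriv[OF sigma]]
        hcosh.tendsto assms tendsto_const) (use hcosh_ge_1[OF kappa _ q[OF that]] assms in auto)
  then show ?thesis unfolding grad_def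
    by (intro tendsto_intros hcosh.tendsto assms) auto
qed

section \<open>Bounded sublevel sets and optimality\<close>

lemma continuous_on_f: "continuous_on (hyp_space \<kappa>) f"
  using f_has_derivative has_derivative_continuous continuous_on_eq_continuous_within by blast

lemma bounded_sublevel: "bounded {x \<in> hyp_space \<kappa>. f x \<le> M}"
proof -
  \<comment> \<open>Above 1, arcosh is at most its \<sigma>-th power, which the term of
    \<open>q 1\<close> alone bounds by M / w 1.\<close>
  define N where "N = max 1 (M / w 1)"
  have 1: "1 \<in> {1..m}" using m by simp
  show ?thesis
  proof (rule boundedI)
    fix x assume x: "x \<in> {x \<in> hyp_space \<kappa>. f x \<le> M}"
    let ?A = "arcosh (hcosh \<kappa> x (q 1))"
    have ge: "hcosh \<kappa> x (q 1) \<ge> 1" using x q 1 kappa by (intro hcosh_ge_1) auto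
    have "?A \<le> N"
    proof (rule ccontr)
      assume "\<not> ?A \<le> N"
      then have A: "?A > 1" "?A > M / w 1" by (auto simp: N_def)
      then have "?A powr 1 \<le> ?A powr \<sigma>" using sigma by (intro powr_mono) auto
      then have "w 1 * ?A \<le> w 1 * ?A powr \<sigma>" using A w_pos[OF 1] by simp
      also have "\<dots> \<le> (\<Sum>i=1..m. w i * arcosh (hcosh \<kappa> x (q i)) powr \<sigma>)"
        using 1 less_imp_le[OF w_pos]
        by (intro member_le_sum[of 1 _ "\<lambda>i. w i * arcosh (hcosh \<kappa> x (q i)) powr \<sigma>"] mult_nonneg_nonneg)
          auto
      also have "\<dots> \<le> M" using x f_eq[of x] by simp
      finally show False using A w_pos[OF 1] by (simp add: field_simps)
    qed
    then have "cosh ?A \<le> cosh N" using ge by (subst cosh_real_nonneg_le_iff) (auto simp: N_def)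
    then have "hcosh \<kappa> (q 1) x \<le> cosh N" using ge by (simp add: hcosh_commute)
    have "norm x \<le> 4 * norm (q 1) * hcosh \<kappa> (q 1) x" using x q[OF 1] kappa by (intro norm_le_hcosh) auto
    also have "\<dots> \<le> 4 * norm (q 1) * cosh N" by (intro mult_left_mono) (fact | simp)+
    finally show "norm x \<le> 4 * norm (q 1) * cosh N" .
  qed
qed

lemma tendsto_f:
  assumes "\<And>k. P k \<in> hyp_space \<kappa>" "p \<in> hyp_space \<kappa>" "P \<longlonglongrightarrow> p"
  shows "(\<lambda>k. f (P k)) \<longlonglongrightarrow> f p"
  using assms by (intro continuous_on_tendsto_compose[OF continuous_on_f]) auto

lemma strict_min_if_stationary:
  assumes "C \<subseteq> hyp_space \<kappa>" "p \<in> C" "\<And>c. c \<in> C \<Longrightarrow> lorentz (grad p) (hyp_log \<kappa> p c) \<ge> 0"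
    and "c \<in> C" "c \<noteq> p"
  shows "f p < f c"
proof -
  have H: "p \<in> hyp_space \<kappa>" "c \<in> hyp_space \<kappa>" using assms by auto
  then have "0 \<le> f' p (hyp_log \<kappa> p c)"
    using assms(3)[OF assms(4)] lorentz_grad[OF hyp_log_in_tangent_space[OF kappa H]] by simp
  with f_above_tangent[OF H] assms(5) show ?thesis by simp
qed

end

subsection \<open>The gradient projection method\<close>

locale hyp_gradient_projection = hyp_center_of_mass \<kappa> \<sigma> m \<mu> q
  for \<kappa> \<sigma> :: real and m :: nat and \<mu> :: "nat \<Rightarrow> real" and q :: "nat \<Rightarrow> (real ^ 'n) \<times> real" +
  fixes C :: "((real ^ 'n) \<times> real) set" and \<rho> \<beta> \<alpha>_min \<alpha>_max :: real
    and P z :: "nat \<Rightarrow> (real ^ 'n) \<times> real" and \<alpha> \<theta> :: "nat \<Rightarrow> real" and L :: "nat \<Rightarrow> nat"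
  assumes C: "C \<noteq> {}" "closed C" "C \<subseteq> hyp_space \<kappa>" "hyp_convex \<kappa> C"
    and rho: "0 < \<rho>" "\<rho> < 1" and beta: "0 < \<beta>" "\<beta> < 1"
    and alpha: "0 < \<alpha>_min" "\<And>k. \<alpha>_min \<le> \<alpha> k" "\<And>k. \<alpha> k \<le> \<alpha>_max"
    and start: "P 0 \<in> C" "0 < \<theta> 0" "\<theta> 0 < 1"
    and z_eq: "\<And>k. z k = hyp_proj \<kappa> C (hyp_exp \<kappa> (P k) (- \<alpha> k *\<^sub>R hyp_grad \<kappa> f (P k)))"
    and L_eq: "\<And>k. L k = (LEAST l. l \<ge> 1 \<and>
      f (hyp_exp \<kappa> (P k) ((\<beta> ^ l * \<theta> k) *\<^sub>R hyp_log \<kappa> (P k) (z k)))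
      \<le> f (P k) + \<rho> * \<beta> ^ l * \<theta> k * lorentz (hyp_grad \<kappa> f (P k)) (hyp_log \<kappa> (P k) (z k)))"
    and P_Suc: "\<And>k. P (Suc k) = hyp_exp \<kappa> (P k) ((\<beta> ^ L k * \<theta> k) *\<^sub>R hyp_log \<kappa> (P k) (z k))"
    and theta_Suc: "\<And>k. \<theta> (Suc k) = \<beta> ^ (L k - 1) * \<theta> k"
begin

section \<open>Feasibility of the iterates and the line search\<close>

abbreviation V :: "nat \<Rightarrow> (real ^ 'n) \<times> real" where "V k \<equiv> hyp_log \<kappa> (P k) (z k)"
abbreviation y :: "nat \<Rightarrow> (real ^ 'n) \<times> real" where "y k \<equiv> hyp_exp \<kappa> (P k) (- \<alpha> k *\<^sub>R grad (P k))"

lemma theta_pos: "0 < \<theta> k"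
  by (induction k) (use start beta in \<open>auto simp: theta_Suc\<close>)

lemma theta_Suc_le: "\<theta> (Suc k) \<le> \<theta> k"
  using theta_pos[of k] beta power_le_one[of \<beta> "L k - 1"]
  by (simp add: theta_Suc mult_le_cancel_right1)

lemma theta_less_1: "\<theta> k < 1"
  by (induction k) (use start theta_Suc_le in \<open>auto intro: le_less_trans\<close>)

text \<open>Conditional on \<open>P k \<in> C\<close>, since feasibility is itself proved by an
  induction that uses this.\<close>

lemma closest_if:
  assumes "P k \<in> C" shows "is_hyp_closest \<kappa> C (y k) (z k)"
proof -
  have H: "P k \<in> hyp_space \<kappa>" using assms C by auto
  show ?thesis unfolding z_eq hyp_grad_eq[OF H]
    by (intro is_hyp_closest_hyp_proj hyp_exp_in_hyp_space tangent_space_scaleR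
        grad_in_tangent_space kappa C H)
qed

lemma P_in_C: "P k \<in> C"
proof (induction k)
  case (Suc k)
  have "z k \<in> C" using closest_if[OF Suc] by (simp add: is_hyp_closest_def)
  \<comment> \<open>Whatever the exponent, the step lies in [0, 1], so the next iterate is on the
    segment to \<open>z k\<close>. Nothing about the line search is known yet.\<close>
  moreover have "\<beta> ^ L k * \<theta> k \<le> 1 * 1"
    using beta theta_pos[of k] theta_less_1[of k] by (intro mult_mono power_le_one) auto
  ultimately show ?case unfolding P_Suc
    using beta theta_pos[of k] Suc by (intro hyp_convexD kappa C) auto
qed (fact start)

lemma P_in_H: "P k \<in> hyp_space \<kappa>" using P_in_C C by auto

lemmas closest = closest_if[OF P_in_C]

lemma z_in_C: "z k \<in> C" using closest[of k] by (simp add: is_hyp_closest_def)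

lemma z_in_H: "z k \<in> hyp_space \<kappa>" using z_in_C C by auto

lemma V_tangent: "V k \<in> tangent_space (P k)"
  by (intro hyp_log_in_tangent_space kappa P_in_H z_in_H)

lemma y_in_H: "y k \<in> hyp_space \<kappa>"
  by (intro hyp_exp_in_hyp_space kappa P_in_H tangent_space_scaleR grad_in_tangent_space)

lemma alpha_pos: "0 < \<alpha> k" using alpha by (meson less_le_trans)

lemma V_eq_0: "z k = P k \<Longrightarrow> V k = 0" by (simp add: hyp_log_def)

lemma slope_neg: "z k \<noteq> P k \<Longrightarrow> lorentz (grad (P k)) (V k) < 0"
  by (rule hyp_closest_descent(1)[OF kappa C(3,4) P_in_C grad_in_tangent_space[OF P_in_H] alpha_pos closest])

lemma slope_nonpos: "lorentz (grad (P k)) (V k) \<le> 0"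
  using slope_neg[of k] V_eq_0[of k] by (cases "z k = P k") (auto simp: lorentz.zero_right)

text \<open>For \<open>z k \<noteq> P k\<close> the quotients tend to the negative slope \<phi>, and
  \<phi> < \<rho> \<phi> as \<rho> < 1. Otherwise the curve is constant and every exponent passes.
  This makes the \<open>LEAST\<close> in \<open>L_eq\<close> attained.\<close>

lemma armijo_exists:
  "\<exists>l\<ge>1. f (hyp_exp \<kappa> (P k) ((\<beta> ^ l * \<theta> k) *\<^sub>R V k))
     \<le> f (P k) + \<rho> * \<beta> ^ l * \<theta> k * lorentz (grad (P k)) (V k)"
proof (cases "z k = P k")
  case True
  then have "V k = 0" by (rule V_eq_0)
  then show ?thesis unfolding \<open>V k = 0\<close> by (auto simp: hyp_exp_def lorentz.zero_right)
next
  case False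
  define \<phi> where "\<phi> = lorentz (grad (P k)) (V k)"
  have \<phi>: "\<phi> = f' (P k) (V k)" "\<phi> < \<rho> * \<phi>"
    using lorentz_grad[OF V_tangent] slope_neg[OF False] rho by (auto simp: \<phi>_def)
  define \<tau> where "\<tau> l = \<beta> ^ l * \<theta> k" for l
  have \<tau>: "\<tau> l > 0" for l using beta theta_pos by (simp add: \<tau>_def)
  have "\<tau> \<longlonglongrightarrow> 0" unfolding \<tau>_def
    using beta by (intro tendsto_mult_left_zero LIMSEQ_realpow_zero) auto
  then have "(\<lambda>l. (f (hyp_exp \<kappa> (P k) (\<tau> l *\<^sub>R V k)) - f (P k)) / \<tau> l) \<longlonglongrightarrow> \<phi>"
    unfolding \<phi>(1) using \<tau> by (intro tendsto_f_difference_quotient P_in_H V_tangent) (auto simp: less_imp_neq[OF \<tau>, symmetric])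
  from order_tendstoD(2)[OF this \<phi>(2)] eventually_ge_at_top[of 1]
  have "\<forall>\<^sub>F l in sequentially. l \<ge> 1 \<and> (f (hyp_exp \<kappa> (P k) (\<tau> l *\<^sub>R V k)) - f (P k)) / \<tau> l < \<rho> * \<phi>"
    by eventually_elim auto
  then obtain l where "l \<ge> 1" "(f (hyp_exp \<kappa> (P k) (\<tau> l *\<^sub>R V k)) - f (P k)) / \<tau> l < \<rho> * \<phi>"
    by (auto simp: eventually_sequentially)
  then have "f (hyp_exp \<kappa> (P k) (\<tau> l *\<^sub>R V k)) \<le> f (P k) + \<rho> * \<phi> * \<tau> l"
    using \<tau>[of l] by (simp add: divide_less_eq)
  with \<open>l \<ge> 1\<close> show ?thesis by (auto simp: \<tau>_def \<phi>_def mult_ac)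
qed

text \<open>As \<theta> is updated with exponent \<open>L k - 1\<close>, the accepted step is
  \<open>\<beta> * \<theta> (Suc k)\<close> and the trial just before it is
  \<open>\<theta> (Suc k)\<close>. That trial was actually rejected only if
  \<open>2 \<le> L k\<close>, since exponent 0 is never tested.\<close>

lemma L_props:
  shows L_ge_1: "L k \<ge> 1"
    and armijo: "f (P (Suc k)) \<le> f (P k) + \<rho> * \<beta> * \<theta> (Suc k) * lorentz (grad (P k)) (V k)"
    and armijo_fails: "2 \<le> L k \<Longrightarrow> f (P k) + \<rho> * \<theta> (Suc k) * lorentz (grad (P k)) (V k)
        < f (hyp_exp \<kappa> (P k) (\<theta> (Suc k) *\<^sub>R V k))"
proof -
  define A where "A l \<longleftrightarrow> l \<ge> 1 \<and> f (hyp_exp \<kappa> (P k) ((\<beta> ^ l * \<theta> k) *\<^sub>R V k))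
     \<le> f (P k) + \<rho> * \<beta> ^ l * \<theta> k * lorentz (grad (P k)) (V k)" for l
  have L: "L k = (LEAST l. A l)"
    unfolding L_eq A_def hyp_grad_eq[OF P_in_H] ..
  have AL: "A (L k)" unfolding L by (rule LeastI_ex) (use armijo_exists in \<open>auto simp: A_def\<close>)
  then show 1: "L k \<ge> 1" by (simp add: A_def)
  then have "\<beta> ^ L k * \<theta> k = \<beta> * \<theta> (Suc k)"
    by (simp add: theta_Suc flip: power_Suc mult.assoc)
  with AL show "f (P (Suc k)) \<le> f (P k) + \<rho> * \<beta> * \<theta> (Suc k) * lorentz (grad (P k)) (V k)"
    by (simp add: A_def P_Suc mult.assoc)
  assume "2 \<le> L k"
  then have "\<not> A (L k - 1)" unfolding L by (intro not_less_Least) simp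
  with \<open>2 \<le> L k\<close> show "f (P k) + \<rho> * \<theta> (Suc k) * lorentz (grad (P k)) (V k)
        < f (hyp_exp \<kappa> (P k) (\<theta> (Suc k) *\<^sub>R V k))"
    by (simp add: A_def theta_Suc mult.assoc not_le)
qed

section \<open>Monotone values and convergent subsequences\<close>

lemma f_Suc_le: "f (P (Suc k)) \<le> f (P k)"
proof -
  have "\<rho> * \<beta> * \<theta> (Suc k) * lorentz (grad (P k)) (V k) \<le> 0"
    using slope_nonpos rho beta theta_pos less_imp_le by (intro mult_nonneg_nonpos mult_nonneg_nonneg) auto
  with armijo[of k] show ?thesis by simp
qed

lemma f_le_start: "f (P k) \<le> f (P 0)"
  by (induction k) (use f_Suc_le in \<open>auto intro: order_trans\<close>)

lemma convergent_f: "convergent (\<lambda>k. f (P k))"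
proof (rule Bseq_monoseq_convergent)
  show "monoseq (\<lambda>k. f (P k))" 
    using f_Suc_le by (intro decseq_imp_monoseq decseq_SucI)
  have "0 \<le> f x" if "x \<in> hyp_space \<kappa>" for x
    using that less_imp_le[OF w_pos] by (auto simp: f_eq intro!: sum_nonneg mult_nonneg_nonneg)
  then show "Bseq (\<lambda>k. f (P k))"
    using f_le_start P_in_H by (intro BseqI'[of _ "f (P 0)"]) auto
qed

lemma bounded_P: "bounded (range P)"
  by (rule bounded_subset[OF bounded_sublevel]) (use P_in_H f_le_start in blast)

text \<open>Iterates and step sizes are bounded, and along a convergent subsequence the points
  \<open>y k\<close> converge by continuity. The obtuse angle bounds the projections, and
  closestness survives the limit by testing against each fixed \<open>c\<close>. The lower bound
  \<alpha>_min keeps the limit step positive.\<close>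

lemma convergent_subsequence:
  assumes "strict_mono r0"
  obtains s a ps zs where "strict_mono (s :: nat \<Rightarrow> nat)" "(\<lambda>k. P (r0 (s k))) \<longlonglongrightarrow> ps"
    "(\<lambda>k. \<alpha> (r0 (s k))) \<longlonglongrightarrow> a" "(\<lambda>k. z (r0 (s k))) \<longlonglongrightarrow> zs"
    "ps \<in> C" "zs \<in> C" "0 < a" "is_hyp_closest \<kappa> C (hyp_exp \<kappa> ps (- a *\<^sub>R grad ps)) zs"
proof -
  have "bounded (range (\<lambda>k. (P (r0 k), \<alpha> (r0 k))))"
  proof (rule bounded_subset[OF bounded_Times])
    show "bounded (range P)" by (rule bounded_P)
    show "bounded {\<alpha>_min..\<alpha>_max}" by simp
  qed (use alpha in auto)
  then obtain l s1 where s1: "strict_mono (s1 :: nat \<Rightarrow> nat)" "((\<lambda>k. (P (r0 k), \<alpha> (r0 k))) \<circ> s1) \<longlonglongrightarrow> l"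
    using bounded_imp_convergent_subsequence by blast
  define ps a r1 where "ps = fst l" and "a = snd l" and "r1 k = r0 (s1 k)" for k
  have P1: "(\<lambda>k. P (r1 k)) \<longlonglongrightarrow> ps" and a1: "(\<lambda>k. \<alpha> (r1 k)) \<longlonglongrightarrow> a"
    using tendsto_fst[OF s1(2)] tendsto_snd[OF s1(2)] by (simp_all add: ps_def a_def r1_def comp_def)
  have ps: "ps \<in> C" using closed_sequentially[OF C(2) _ P1] P_in_C by simp
  then have psH: "ps \<in> hyp_space \<kappa>" using C by auto
  have "\<alpha>_min \<le> a" using alpha by (intro LIMSEQ_le_const[OF a1]) auto
  then have a: "0 < a" using alpha by simp
  have y1: "(\<lambda>k. y (r1 k)) \<longlonglongrightarrow> hyp_exp \<kappa> ps (- a *\<^sub>R grad ps)"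
    by (intro tendsto_hyp_exp kappa P_in_H psH tangent_space_scaleR grad_in_tangent_space
        tendsto_intros tendsto_grad P1 a1)
  have "(\<lambda>k. 4 * norm (P (r1 k)) * hcosh \<kappa> (P (r1 k)) (y (r1 k)))
    \<longlonglongrightarrow> 4 * norm ps * hcosh \<kappa> ps (hyp_exp \<kappa> ps (- a *\<^sub>R grad ps))"
    by (intro tendsto_intros hcosh.tendsto P1 y1)
  then have "Bseq (\<lambda>k. 4 * norm (P (r1 k)) * hcosh \<kappa> (P (r1 k)) (y (r1 k)))"
    by (intro convergent_imp_Bseq convergentI)
  then obtain B where B: "\<And>k. norm (4 * norm (P (r1 k)) * hcosh \<kappa> (P (r1 k)) (y (r1 k))) \<le> B"
    by (auto simp: Bseq_def)
  have "bounded (range (\<lambda>k. z (r1 k)))"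
  proof (rule boundedI)
    fix v assume "v \<in> range (\<lambda>k. z (r1 k))"
    then obtain k where v: "v = z (r1 k)" by blast
    let ?k = "r1 k"
    \<comment> \<open>Projecting does not move \<open>z\<close> farther from \<open>P\<close> than
      \<open>y\<close> is.\<close>
    have "hcosh \<kappa> (P ?k) (z ?k) * 1 \<le> hcosh \<kappa> (P ?k) (z ?k) * hcosh \<kappa> (z ?k) (y ?k)"
      using hcosh_ge_1[OF kappa z_in_H y_in_H] hcosh_pos[OF kappa P_in_H z_in_H]
      by (intro mult_left_mono) (auto intro: less_imp_le)
    also have "\<dots> \<le> hcosh \<kappa> (P ?k) (y ?k)"
      using hyp_closest_obtuse[OF kappa C(3,4) closest P_in_C] by (simp add: hcosh_commute)
    finally have le: "hcosh \<kappa> (P ?k) (z ?k) \<le> hcosh \<kappa> (P ?k) (y ?k)" by simp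
    have "norm (z ?k) \<le> 4 * norm (P ?k) * hcosh \<kappa> (P ?k) (z ?k)"
      by (rule norm_le_hcosh[OF kappa P_in_H z_in_H])
    also have "\<dots> \<le> 4 * norm (P ?k) * hcosh \<kappa> (P ?k) (y ?k)"
      by (rule mult_left_mono[OF le]) simp
    also have "\<dots> \<le> B" using B[of k] unfolding real_norm_def by (rule abs_le_D1)
    finally show "norm v \<le> B" unfolding v .
  qed
  then obtain zs s2 where s2: "strict_mono (s2 :: nat \<Rightarrow> nat)" "((\<lambda>k. z (r1 k)) \<circ> s2) \<longlonglongrightarrow> zs"
    using bounded_imp_convergent_subsequence by blast
  then have z2: "(\<lambda>k. z (r1 (s2 k))) \<longlonglongrightarrow> zs" by (simp add: comp_def)
  note sub = LIMSEQ_subseq_LIMSEQ[OF _ s2(1), unfolded comp_def]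
  have zs: "zs \<in> C" using closed_sequentially[OF C(2) _ z2] z_in_C by simp
  have "hcosh \<kappa> (hyp_exp \<kappa> ps (- a *\<^sub>R grad ps)) zs \<le> hcosh \<kappa> (hyp_exp \<kappa> ps (- a *\<^sub>R grad ps)) c"
    if "c \<in> C" for c
  proof (rule LIMSEQ_le)
    show "(\<lambda>k. hcosh \<kappa> (y (r1 (s2 k))) (z (r1 (s2 k)))) \<longlonglongrightarrow> hcosh \<kappa> (hyp_exp \<kappa> ps (- a *\<^sub>R grad ps)) zs"
      by (intro hcosh.tendsto sub[OF y1] z2)
    show "(\<lambda>k. hcosh \<kappa> (y (r1 (s2 k))) c) \<longlonglongrightarrow> hcosh \<kappa> (hyp_exp \<kappa> ps (- a *\<^sub>R grad ps)) c"
      by (intro hcosh.tendsto sub[OF y1] tendsto_const)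
    show "\<exists>N. \<forall>n\<ge>N. hcosh \<kappa> (y (r1 (s2 n))) (z (r1 (s2 n))) \<le> hcosh \<kappa> (y (r1 (s2 n))) c"
      using closest that by (auto simp: is_hyp_closest_def)
  qed
  then have "is_hyp_closest \<kappa> C (hyp_exp \<kappa> ps (- a *\<^sub>R grad ps)) zs"
    using zs by (simp add: is_hyp_closest_def)
  then show thesis
    using sub[OF P1] sub[OF a1] z2 ps zs a strict_mono_o[OF s1(1) s2(1)]
    by (intro that[of "s1 \<circ> s2" ps a zs]) (simp_all add: r1_def)
qed

section \<open>Slopes in the limit\<close>

lemma theta_tendsto_cases:
  obtains \<theta>' where "0 < \<theta>'" "\<And>k. \<theta>' \<le> \<theta> k" | "\<theta> \<longlonglongrightarrow> 0"
proof -
  have "decseq \<theta>" using theta_Suc_le by (simp add: decseq_SucI)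
  then obtain \<theta>' where \<theta>': "\<theta> \<longlonglongrightarrow> \<theta>'" "\<And>k. \<theta>' \<le> \<theta> k"
    using decseq_convergent[of \<theta> 0] theta_pos by (auto intro: less_imp_le)
  moreover have "0 \<le> \<theta>'" using theta_pos less_imp_le by (intro LIMSEQ_le_const[OF \<theta>'(1)]) auto
  ultimately show thesis using that(1)[of \<theta>'] that(2) by (cases "\<theta>' = 0") auto
qed

text \<open>The index map \<open>r0\<close> is chosen before compactness is invoked, so the
  statement allows any further subsequence \<open>s\<close>. It is \<open>id\<close> if the trial
  steps stay away from 0, and otherwise enumerates indices with a rejection.\<close>

lemma slope_limit_nonneg:
  obtains r0 where "strict_mono (r0 :: nat \<Rightarrow> nat)"
    and "\<And>s ps zs. \<lbrakk>strict_mono s; (\<lambda>k. P (r0 (s k))) \<longlonglongrightarrow> ps; (\<lambda>k. z (r0 (s k))) \<longlonglongrightarrow> zs;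
          ps \<in> hyp_space \<kappa>; zs \<in> hyp_space \<kappa>\<rbrakk> \<Longrightarrow> 0 \<le> lorentz (grad ps) (hyp_log \<kappa> ps zs)"
proof -
  define \<phi> where "\<phi> k = lorentz (grad (P k)) (V k)" for k
  have \<phi>_lim: "(\<lambda>k. \<phi> (r k)) \<longlonglongrightarrow> lorentz (grad ps) (hyp_log \<kappa> ps zs)"
    if "(\<lambda>k. P (r k)) \<longlonglongrightarrow> ps" "(\<lambda>k. z (r k)) \<longlonglongrightarrow> zs" "ps \<in> hyp_space \<kappa>" "zs \<in> hyp_space \<kappa>" for r ps zs
    unfolding \<phi>_def
    by (intro lorentz.tendsto tendsto_grad tendsto_hyp_log kappa P_in_H z_in_H that)
  show thesis
  proof (cases rule: theta_tendsto_cases)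
    case (1 \<theta>')
    have "\<phi> \<longlonglongrightarrow> 0"
    proof -
      obtain l where l: "(\<lambda>k. f (P k)) \<longlonglongrightarrow> l" using convergent_f by (auto simp: convergent_def)
      have "(\<lambda>k. (f (P (Suc k)) - f (P k)) / (\<rho> * \<beta> * \<theta>')) \<longlonglongrightarrow> (l - l) / (\<rho> * \<beta> * \<theta>')"
        using rho beta 1 by (intro tendsto_intros l LIMSEQ_Suc[OF l]) auto
      then have lim: "(\<lambda>k. (f (P (Suc k)) - f (P k)) / (\<rho> * \<beta> * \<theta>')) \<longlonglongrightarrow> 0" by simp
      have "(f (P (Suc k)) - f (P k)) / (\<rho> * \<beta> * \<theta>') \<le> \<phi> k" for k
      proof -
        have "f (P (Suc k)) - f (P k) \<le> \<rho> * \<beta> * \<theta> (Suc k) * \<phi> k" using armijo[of k] by (simp add: \<phi>_def)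
        \<comment> \<open>The slope is nonpositive, so lowering \<theta> to its bound only raises
          the product.\<close>
        also have "\<dots> \<le> \<rho> * \<beta> * \<theta>' * \<phi> k"
          using rho beta 1 slope_nonpos[of k] by (intro mult_right_mono_neg mult_left_mono) (auto simp: \<phi>_def)
        finally show ?thesis using rho beta 1 by (simp add: divide_le_eq mult_ac)
      qed
      then show ?thesis
        by (intro tendsto_sandwich[OF _ _ lim tendsto_const]) (use slope_nonpos in \<open>auto simp: \<phi>_def\<close>)
    qed
    show thesis
    proof (rule that[of id])
      fix s :: "nat \<Rightarrow> nat" and ps zs
      assume s: "strict_mono s" "(\<lambda>k. P (id (s k))) \<longlonglongrightarrow> ps" "(\<lambda>k. z (id (s k))) \<longlonglongrightarrow> zs"
          "ps \<in> hyp_space \<kappa>" "zs \<in> hyp_space \<kappa>"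
      have "(\<lambda>k. \<phi> (s k)) \<longlonglongrightarrow> lorentz (grad ps) (hyp_log \<kappa> ps zs)"
        using s by (intro \<phi>_lim) auto
      moreover have "(\<lambda>k. \<phi> (s k)) \<longlonglongrightarrow> 0"
        using LIMSEQ_subseq_LIMSEQ[OF \<open>\<phi> \<longlonglongrightarrow> 0\<close> s(1)] by (simp add: comp_def)
      ultimately show "0 \<le> lorentz (grad ps) (hyp_log \<kappa> ps zs)" using LIMSEQ_unique by force
    qed (simp add: strict_mono_def)
  next
    case 2
    \<comment> \<open>Backtracking rejects a step infinitely often, with trial steps \<open>\<theta> (Suc k)\<close> tending to 0.\<close>
    have "infinite {k. 2 \<le> L k}"
    proof
      assume "finite {k. 2 \<le> L k}"
      then obtain N where N: "\<And>k. 2 \<le> L k \<Longrightarrow> k < N" by (auto simp: finite_nat_set_iff_bounded)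
      \<comment> \<open>With exponent \<open>L k - 1 = 0\<close> the trial step would stay constant
        and positive from \<open>N\<close> on.\<close>
      have "L k = 1" if "N \<le> k" for k using N[of k] L_ge_1[of k] that by force
      then have "\<theta> (N + k) = \<theta> N" for k by (induction k) (auto simp: theta_Suc)
      then have "(\<lambda>k. \<theta> (k + N)) = (\<lambda>k. \<theta> N)" by (auto simp: add.commute)
      with LIMSEQ_ignore_initial_segment[OF 2, of N] have "\<theta> N = 0"
        by (simp add: LIMSEQ_const_iff)
      with theta_pos[of N] show False by simp
    qed
    from infinite_enumerate[OF this] obtain r0 where r0: "strict_mono (r0 :: nat \<Rightarrow> nat)" "\<And>n. 2 \<le> L (r0 n)"
      by auto
    show thesis
    proof (rule that[OF r0(1)])
      fix s :: "nat \<Rightarrow> nat" and ps zs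
      assume s: "strict_mono s" "(\<lambda>k. P (r0 (s k))) \<longlonglongrightarrow> ps" "(\<lambda>k. z (r0 (s k))) \<longlonglongrightarrow> zs"
          "ps \<in> hyp_space \<kappa>" "zs \<in> hyp_space \<kappa>"
      let ?r = "\<lambda>k. r0 (s k)" and ?v = "hyp_log \<kappa> ps zs"
      have "(\<lambda>k. (f (hyp_exp \<kappa> (P (?r k)) (\<theta> (Suc (?r k)) *\<^sub>R V (?r k))) - f (P (?r k))) / \<theta> (Suc (?r k)))
          \<longlonglongrightarrow> f' ps ?v"
      proof (rule tendsto_f_difference_quotient[OF P_in_H V_tangent s(2)])
        show "(\<lambda>k. V (?r k)) \<longlonglongrightarrow> ?v"
          by (intro tendsto_hyp_log kappa P_in_H z_in_H s)
        show "(\<lambda>k. \<theta> (Suc (?r k))) \<longlonglongrightarrow> 0"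
          using LIMSEQ_subseq_LIMSEQ[OF LIMSEQ_Suc[OF 2] strict_mono_o[OF r0(1) s(1)]]
          by (simp add: comp_def)
        show "\<theta> (Suc (?r k)) \<noteq> 0" for k using theta_pos[of "Suc (?r k)"] by simp
      qed
      moreover have "f' ps ?v = lorentz (grad ps) ?v"
        by (rule lorentz_grad[OF hyp_log_in_tangent_space[OF kappa s(4,5)], symmetric])
      moreover have "(\<lambda>k. \<rho> * \<phi> (?r k)) \<longlonglongrightarrow> \<rho> * lorentz (grad ps) ?v"
        by (intro tendsto_intros \<phi>_lim s)
      \<comment> \<open>A rejected trial has a quotient above \<rho> \<phi>. In the limit the slope
        s satisfies \<rho> s \<le> s, hence s \<ge> 0 because \<rho> < 1.\<close>
      moreover have "\<rho> * \<phi> (?r k)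
          \<le> (f (hyp_exp \<kappa> (P (?r k)) (\<theta> (Suc (?r k)) *\<^sub>R V (?r k))) - f (P (?r k))) / \<theta> (Suc (?r k))" for k
        using armijo_fails[OF r0(2), of "s k"] theta_pos[of "Suc (?r k)"]
        by (simp add: le_divide_eq \<phi>_def mult_ac)
      ultimately have "\<rho> * lorentz (grad ps) ?v \<le> f' ps ?v" "f' ps ?v = lorentz (grad ps) ?v"
        by (blast intro: LIMSEQ_le)+
      then have "\<rho> * lorentz (grad ps) ?v \<le> lorentz (grad ps) ?v" by simp
      then have "0 \<le> (1 - \<rho>) * lorentz (grad ps) ?v" by (simp add: algebra_simps)
      then show "0 \<le> lorentz (grad ps) ?v" using rho by (simp add: zero_le_mult_iff)
    qed
  qed
qed

section \<open>Convergence of the whole sequence\<close>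

theorem converges_to_strict_minimizer:
  obtains x where "x \<in> C" "\<And>c. c \<in> C \<Longrightarrow> c \<noteq> x \<Longrightarrow> f x < f c" "P \<longlonglongrightarrow> x"
proof (rule slope_limit_nonneg)
  fix r0 :: "nat \<Rightarrow> nat"
  assume r0: "strict_mono r0"
    "\<And>s ps zs. \<lbrakk>strict_mono s; (\<lambda>k. P (r0 (s k))) \<longlonglongrightarrow> ps; (\<lambda>k. z (r0 (s k))) \<longlonglongrightarrow> zs;
          ps \<in> hyp_space \<kappa>; zs \<in> hyp_space \<kappa>\<rbrakk> \<Longrightarrow> 0 \<le> lorentz (grad ps) (hyp_log \<kappa> ps zs)"
  obtain s a x zs where s: "strict_mono (s :: nat \<Rightarrow> nat)"
    and P_lim: "(\<lambda>k. P (r0 (s k))) \<longlonglongrightarrow> x" and "(\<lambda>k. \<alpha> (r0 (s k))) \<longlonglongrightarrow> a"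
    and z_lim: "(\<lambda>k. z (r0 (s k))) \<longlonglongrightarrow> zs"
    and x: "x \<in> C" "zs \<in> C" "0 < a" "is_hyp_closest \<kappa> C (hyp_exp \<kappa> x (- a *\<^sub>R grad x)) zs"
    by (rule convergent_subsequence[OF r0(1)])
  have H: "x \<in> hyp_space \<kappa>" "zs \<in> hyp_space \<kappa>" using x C by auto
  note descent = hyp_closest_descent[OF kappa C(3,4) x(1) grad_in_tangent_space[OF H(1)] x(3,4)]
  have "zs = x" using descent(1) r0(2)[OF s P_lim z_lim H] by (meson not_le)
  then have min: "f x < f c" if "c \<in> C" "c \<noteq> x" for c
    using strict_min_if_stationary[OF C(3) x(1)] descent(2) that by blast
  obtain l where l: "(\<lambda>k. f (P k)) \<longlonglongrightarrow> l" using convergent_f by (auto simp: convergent_def)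
  \<comment> \<open>Monotonicity gives all limit points the same value, so strictness of the minimum
    leaves only one.\<close>
  have l_eq: "f x' = l" if "strict_mono r" "(\<lambda>k. P (r k)) \<longlonglongrightarrow> x'" "x' \<in> hyp_space \<kappa>" for r x'
    using LIMSEQ_unique[OF tendsto_f[OF P_in_H that(3,2)]] LIMSEQ_subseq_LIMSEQ[OF l that(1)]
    by (simp add: comp_def)
  have "f x = l" using l_eq[OF strict_mono_o[OF r0(1) s]] P_lim H by (simp add: comp_def)
  have "P \<longlonglongrightarrow> x"
  proof (rule ccontr)
    assume "\<not> P \<longlonglongrightarrow> x"
    then obtain e where e: "e > 0" "\<not> (\<exists>N. \<forall>n\<ge>N. dist (P n) x < e)"
      unfolding lim_sequentially by blast
    \<comment> \<open>Iterates at distance at least \<open>e\<close> from \<open>x\<close> recur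
      forever; a convergent subsequence of them has its limit in \<open>C\<close> with the minimal
      value.\<close>
    then have "\<forall>N. \<exists>n\<ge>N. n \<in> {k. e \<le> dist (P k) x}" by (simp add: not_less)
    then have "infinite {k. e \<le> dist (P k) x}" unfolding infinite_nat_iff_unbounded_le .
    from infinite_enumerate[OF this] obtain r where r: "strict_mono (r :: nat \<Rightarrow> nat)" "\<And>n. e \<le> dist (P (r n)) x"
      by auto
    obtain s x' where s: "strict_mono (s :: nat \<Rightarrow> nat)"
      and x': "(\<lambda>k. P (r (s k))) \<longlonglongrightarrow> x'" "x' \<in> C"
      by (rule convergent_subsequence[OF r(1)])
    have "f x' = l" using l_eq[OF strict_mono_o[OF r(1) s], of x'] x' subsetD[OF C(3) x'(2)]
      by (simp add: comp_def)
    then have "x' = x" using min[OF x'(2)] \<open>f x = l\<close> by auto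
    then have "(\<lambda>k. dist (P (r (s k))) x) \<longlonglongrightarrow> 0" using x'(1) by (simp flip: tendsto_dist_iff)
    then have "e \<le> 0" using r(2) by (intro LIMSEQ_le_const) auto
    with e(1) show False by simp
  qed
  with x(1) min show thesis by (rule that)
qed

end

theorem theorem26:
  fixes C :: "((real ^ 'n) \<times> real) set"
    and q p :: "nat \<Rightarrow> (real ^ 'n) \<times> real"
    and \<mu> :: "nat \<Rightarrow> real"
    and m :: nat
    and \<kappa> \<sigma> \<rho> \<beta> \<theta>0 \<alpha>_min \<alpha>_max :: real
  assumes "\<kappa> > 0"
    and "C \<noteq> {}" and "closed C" and "C \<subseteq> hyp_space \<kappa>" and "hyp_convex \<kappa> C"
    and "m \<ge> 1"
    and "\<And>i. i \<in> {1..m} \<Longrightarrow> q i \<in> hyp_space \<kappa>" and "inj_on q {1..m}"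
    and "\<And>i. i \<in> {1..m} \<Longrightarrow> \<mu> i > 0" and "(\<Sum>i=1..m. \<mu> i) = 1"
    and "\<sigma> \<ge> 2"
    and "0 < \<rho>" and "\<rho> < 1" and "0 < \<beta>" and "\<beta> < 1" and "0 < \<theta>0" and "\<theta>0 < 1"
    and "0 < \<alpha>_min" and "0 < \<alpha>_max"
    and "grad_proj_backtracking \<kappa> C (center_of_mass_fun \<kappa> \<sigma> m \<mu> q) \<rho> \<beta> \<theta>0 \<alpha>_min \<alpha>_max p"
    and "\<And>k. hyp_grad \<kappa> (center_of_mass_fun \<kappa> \<sigma> m \<mu> q) (p k) \<noteq> 0"
  shows "\<exists>x. is_arg_min (center_of_mass_fun \<kappa> \<sigma> m \<mu> q) (\<lambda>x. x \<in> C) x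
           \<and> (\<forall>x'. is_arg_min (center_of_mass_fun \<kappa> \<sigma> m \<mu> q) (\<lambda>x. x \<in> C) x' \<longrightarrow> x' = x)
           \<and> p \<longlonglongrightarrow> x"
proof -
  let ?f = "center_of_mass_fun \<kappa> \<sigma> m \<mu> q"
  from assms(20) obtain \<alpha> \<theta> y z Q L where p0: "p 0 \<in> C" "\<theta> 0 = \<theta>0"
    and run: "\<And>k. \<alpha>_min \<le> \<alpha> k" "\<And>k. \<alpha> k \<le> \<alpha>_max"
      "\<And>k. y k = hyp_exp \<kappa> (p k) (- \<alpha> k *\<^sub>R hyp_grad \<kappa> ?f (p k))"
      "\<And>k. z k = hyp_proj \<kappa> C (y k)"
      "\<And>k. Q k = (\<lambda>\<tau>. hyp_exp \<kappa> (p k) (\<tau> *\<^sub>R hyp_log \<kappa> (p k) (z k)))"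
      "\<And>k. L k = (LEAST l::nat. l \<ge> 1 \<and> ?f (Q k (\<beta> ^ l * \<theta> k))
          \<le> ?f (p k) + \<rho> * \<beta> ^ l * \<theta> k * lorentz (hyp_grad \<kappa> ?f (p k)) (hyp_log \<kappa> (p k) (z k)))"
      "\<And>k. p (Suc k) = Q k (\<beta> ^ L k * \<theta> k)"
      "\<And>k. \<theta> (Suc k) = \<beta> ^ (L k - 1) * \<theta> k"
    unfolding grad_proj_backtracking_def by blast
  interpret hyp_gradient_projection \<kappa> \<sigma> m \<mu> q C \<rho> \<beta> \<alpha>_min \<alpha>_max p z \<alpha> \<theta> L
  proof unfold_locales
    show "z k = hyp_proj \<kappa> C (hyp_exp \<kappa> (p k) (- \<alpha> k *\<^sub>R hyp_grad \<kappa> ?f (p k)))" for k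
      unfolding run(4) run(3) ..
    show "L k = (LEAST l. l \<ge> 1 \<and>
      ?f (hyp_exp \<kappa> (p k) ((\<beta> ^ l * \<theta> k) *\<^sub>R hyp_log \<kappa> (p k) (z k)))
      \<le> ?f (p k) + \<rho> * \<beta> ^ l * \<theta> k * lorentz (hyp_grad \<kappa> ?f (p k)) (hyp_log \<kappa> (p k) (z k)))" for k
      using run(6)[of k] unfolding run(5) .
    show "p (Suc k) = hyp_exp \<kappa> (p k) ((\<beta> ^ L k * \<theta> k) *\<^sub>R hyp_log \<kappa> (p k) (z k))" for k
      using run(7)[of k] unfolding run(5) .
  qed (use assms p0 run in auto)
  obtain x where x: "x \<in> C" "\<And>c. c \<in> C \<Longrightarrow> c \<noteq> x \<Longrightarrow> ?f x < ?f c" "p \<longlonglongrightarrow> x"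
    using converges_to_strict_minimizer by blast
  \<comment> \<open>The strict inequality away from \<open>x\<close> yields both minimality and
    uniqueness.\<close>
  then have "is_arg_min ?f (\<lambda>x. x \<in> C) x"
    unfolding is_arg_min_def by (metis order.asym)
  moreover have "x' = x" if "is_arg_min ?f (\<lambda>x. x \<in> C) x'" for x'
    using that x unfolding is_arg_min_def by blast
  ultimately show ?thesis using x(3) by blast
qed

end
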